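(* Let $m\ge3$ be an odd integer and $n$ an integer with $2m<n$. Let $f:[0,\infty)\to[0,\infty)$ be continuous with $f(t)=O(t^\sigma)$ as $t\to\infty$, where $0<\sigma<\frac{n}{n-2m}$. Let $v$ be a $C^{2m}$ nonnegative solution of $$0\le-\Delta^m v\le f(v)\quad\text{in }\mathbb{R}^n\setminus B_{1/2}(0).$$ Then $v(y)=O(|y|^b)$ as $|y|\to\infty$, where $$b=\frac{2m(n-2)}{n-\sigma(n-2m)}.$$
   Context: $\Delta^m$ is the $m$-fold iterated Laplacian; $B_{1/2}(0)$ is the open ball of radius $1/2$ about the origin. *)

theory Defs
  imports "HOL-Analysis.Analysis" "HOL-Library.Landau_Symbols"
begin

definition partial_deriv :: "'a::euclidean_space \<Rightarrow> ('a \<Rightarrow> real) \<Rightarrow> 'a \<Rightarrow> real" where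
  "partial_deriv i f x = frechet_derivative f (at x) i"

definition laplacian :: "('a::euclidean_space \<Rightarrow> real) \<Rightarrow> 'a \<Rightarrow> real" where
  "laplacian f x = (\<Sum>i\<in>Basis. partial_deriv i (partial_deriv i f) x)"

text \<open>k-times continuously differentiable on a set U (intended: U open).\<close>
fun C_k_on :: "nat \<Rightarrow> ('a::euclidean_space \<Rightarrow> real) \<Rightarrow> 'a set \<Rightarrow> bool" where
  "C_k_on 0 f U = continuous_on U f"
| "C_k_on (Suc k) f U =
     ((\<forall>x\<in>U. f differentiable (at x)) \<and> (\<forall>i\<in>Basis. C_k_on k (partial_deriv i f) U))"

end

theory Submission
  imports Defs
begin

text \<open>
  Multiplying \<open>v\<close> by a cutoff makes it globally smooth, so that
  \<open>\<integral> v \<Delta>\<^sup>m w = \<integral> w \<Delta>\<^sup>m v\<close> for every compactly supported test function \<open>w\<close>.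
  Put \<open>g = - \<Delta>\<^sup>m v\<close>, \<open>n\<close> for the dimension.
  A radial \<open>w\<close> on the ball of radius \<open>2R\<close> that behaves like \<open>|y|\<close> to the power \<open>2 - n\<close> at the origin and
  satisfies \<open>\<Delta>\<^sup>m w \<ge> 0\<close> bounds the integral of \<open>v\<close> over the ball of radius \<open>R\<close> by a multiple of
  \<open>R\<close> to the power \<open>n - 2 + 2m\<close>, and that of \<open>g\<close> by a multiple of \<open>R\<close> to the power \<open>n - 2\<close>; the sign
  condition needs \<open>m\<close> odd. Testing against a truncated, regularized fundamental solution at \<open>y\<close> gives
  \<open>v(y) \<le> C (|y|^(2m-2) + t^(2m) sup g + |y|^(n-2) / t^(n-2m))\<close>, the supremum being over the ball of radius
  \<open>t \<le> |y|/2\<close> about \<open>y\<close>. In a ball of radius \<open>|y|/2\<close> apply this at the maximum point of \<open>v\<close> times the distance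
  to the boundary to the power \<open>n - 2m\<close>: there \<open>g\<close> is at most a multiple of \<open>(sup v)^\<sigma>\<close>, and the choice
  of \<open>t\<close> balancing the last two terms gives the exponent of the theorem.
\<close>

section \<open>Calculus of k times continuously differentiable functions\<close>

text \<open>The cutoff has a price: for 1/2 <= |x| < 1 nothing is known of g except that it is
  bounded. In the mass bounds this annulus is the only source of the right-hand side, and the large
  test function has size R^(n-2) there; this is where both exponents come from. For the pointwise
  bound the regularized kernel is the bubble (|z|^2 + e)^(-(n-2m)/2). At exactly this exponent
  \<open>\<Delta>^m\<close> turns it into a single term, (-4)^m times a positive multiple of e^m
  (|z|^2 + e)^(-(n+2m)/2); for odd m its negative is therefore a positive approximate point mass. It
  is localized by subtracting a Taylor polynomial at the edge of the ball and continuing by zero.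
  This costs an error bounded independently of e, and the kernel stays below the pure power. The
  weight exponent n - 2m equals the power of t in the denominator, so the distance to the boundary
  cancels when the balancing radius does not fit into the ball. When it fits, M <= C r^q
  M^\<open>\<theta>\<close> results with \<open>\<theta>\<close> = \<open>\<sigma>\<close>(n-2m)/n,
  and the bound on \<open>\<sigma>\<close> says that \<open>\<theta>\<close> < 1.\<close>

lemma partial_deriv_eq:
  "(f has_derivative f') (at x) \<Longrightarrow> partial_deriv i f x = f' i"
  by (metis partial_deriv_def frechet_derivative_at)

lemma has_derivative_partial:
  "f differentiable (at x) \<Longrightarrow> (f has_derivative (\<lambda>h. frechet_derivative f (at x) h)) (at x)"
  using frechet_derivative_works by blast

lemma partial_deriv_cong:
  assumes "open U" "x \<in> U" "\<And>y. y \<in> U \<Longrightarrow> f y = g y"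
  shows "partial_deriv i f x = partial_deriv i g x"
proof -
  have "(f has_derivative f') (at x) \<longleftrightarrow> (g has_derivative f') (at x)" for f'
    using has_derivative_transform_within_open[OF _ assms(1,2)] assms(3) by metis
  then show ?thesis by (simp add: partial_deriv_def frechet_derivative_def)
qed

lemma laplacian_cong:
  assumes "open U" "x \<in> U" "\<And>y. y \<in> U \<Longrightarrow> f y = g y"
  shows "laplacian f x = laplacian g x"
  unfolding laplacian_def
  by (intro sum.cong refl partial_deriv_cong[OF assms(1,2)] partial_deriv_cong[OF assms(1)]) (auto simp: assms)

text \<open>Derivatives at a point of an open set see only the values on that set. This locality
  allows a function multiplied by a cutoff to be replaced by the uncut one wherever the cutoff
  equals 1.\<close>

lemma laplacian_funpow_cong:
  assumes "open U" "x \<in> U" "\<And>y. y \<in> U \<Longrightarrow> f y = g y"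
  shows "(laplacian ^^ k) f x = (laplacian ^^ k) g x"
  using assms(2)
proof (induction k arbitrary: x)
  case 0 then show ?case using assms by simp
next
  case (Suc k)
  show ?case using laplacian_cong[OF assms(1) Suc.prems Suc.IH] by simp
qed

lemma C_k_on_cong:
  assumes "open U" "\<And>y. y \<in> U \<Longrightarrow> f y = g y" "C_k_on k f U"
  shows "C_k_on k g U"
  using assms(2,3)
proof (induction k arbitrary: f g)
  case 0 then show ?case by (metis C_k_on.simps(1) continuous_on_cong)
next
  case (Suc k)
  have "g differentiable (at x)" if "x \<in> U" for x
    using Suc.prems has_derivative_transform_within_open[OF _ assms(1) that, of f _ UNIV g] that
    unfolding differentiable_def C_k_on.simps by blast
  moreover have "C_k_on k (partial_deriv i g) U" if "i \<in> Basis" for i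
    using Suc.IH[of "partial_deriv i f" "partial_deriv i g"] partial_deriv_cong[OF assms(1)] Suc.prems that
    by (metis C_k_on.simps(2))
  ultimately show ?case by simp
qed

lemma C_k_on_subset: "C_k_on k f U \<Longrightarrow> V \<subseteq> U \<Longrightarrow> C_k_on k f V"
  by (induction k arbitrary: f) (auto intro: continuous_on_subset)

lemma C_k_on_Un: "open U \<Longrightarrow> open V \<Longrightarrow> C_k_on k f U \<Longrightarrow> C_k_on k f V \<Longrightarrow> C_k_on k f (U \<union> V)"
  by (induction k arbitrary: f) (auto intro: continuous_on_open_Un)

lemma C_k_on_imp_continuous: "C_k_on k f U \<Longrightarrow> continuous_on U f"
  by (cases k) (auto intro!: differentiable_imp_continuous_on differentiable_at_imp_differentiable_on)

lemma C_k_on_SucD: "C_k_on (Suc k) f U \<Longrightarrow> C_k_on k f U"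
proof (induction k arbitrary: f)
  case 0 then show ?case using C_k_on_imp_continuous by (metis C_k_on.simps(1))
qed auto

lemma C_k_on_le: "C_k_on k f U \<Longrightarrow> j \<le> k \<Longrightarrow> C_k_on j f U"
  by (induction k) (auto simp: le_Suc_eq simp del: C_k_on.simps dest: C_k_on_SucD)

text \<open>\<open>partial_deriv\<close> is total and uncontrolled off \<open>U\<close>, so a closed
  formula for the derivative is available only on \<open>U\<close>. Any such formula may be used
  here, which drives the inductions for products, compositions and explicit radial
  functions.\<close>

lemma C_k_on_SucI:
  assumes "open U" "\<And>x. x \<in> U \<Longrightarrow> (f has_derivative f' x) (at x)"
    and "\<And>i. i \<in> Basis \<Longrightarrow> C_k_on k (\<lambda>x. f' x i) U"
  shows "C_k_on (Suc k) f U"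
proof -
  have "C_k_on k (partial_deriv i f) U" if "i \<in> Basis" for i
    by (rule C_k_on_cong[OF assms(1) _ assms(3)[OF that]]) (use partial_deriv_eq assms(2) in metis)
  then show ?thesis using assms(2) by (auto simp: differentiable_def)
qed

lemma C_k_on_const: "C_k_on k (\<lambda>x. c) U"
proof (induction k arbitrary: c)
  case (Suc k)
  have "partial_deriv i (\<lambda>x. c) = (\<lambda>x. 0)" for i :: 'a
    by (rule ext, rule partial_deriv_eq) auto
  with Suc show ?case by simp
qed auto

lemma C_k_on_add:
  assumes "open U" "C_k_on k f U" "C_k_on k g U"
  shows "C_k_on k (\<lambda>x. f x + g x) U"
  using assms(2,3)
proof (induction k arbitrary: f g)
  case (Suc k)
  show ?case
  proof (rule C_k_on_SucI[OF assms(1)])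
    fix x assume "x \<in> U"
    then show "((\<lambda>x. f x + g x) has_derivative
        (\<lambda>h. frechet_derivative f (at x) h + frechet_derivative g (at x) h)) (at x)"
      using Suc.prems by (intro has_derivative_add has_derivative_partial) auto
  next
    fix i :: 'a assume "i \<in> Basis"
    then show "C_k_on k (\<lambda>x. frechet_derivative f (at x) i + frechet_derivative g (at x) i) U"
      using Suc.IH[of "partial_deriv i f" "partial_deriv i g"] Suc.prems
      by (simp add: partial_deriv_def[abs_def])
  qed
qed (auto intro: continuous_on_add)

lemma C_k_on_mult:
  assumes "open U" "C_k_on k f U" "C_k_on k g U"
  shows "C_k_on k (\<lambda>x. f x * g x) U"
  using assms(2,3)
proof (induction k arbitrary: f g)
  case (Suc k)
  show ?case
  proof (rule C_k_on_SucI[OF assms(1)])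
    fix x assume "x \<in> U"
    then show "((\<lambda>x. f x * g x) has_derivative
        (\<lambda>h. f x * frechet_derivative g (at x) h + frechet_derivative f (at x) h * g x)) (at x)"
      using Suc.prems by (intro has_derivative_mult has_derivative_partial) auto
  next
    fix i :: 'a assume "i \<in> Basis"
    then show "C_k_on k (\<lambda>x. f x * frechet_derivative g (at x) i + frechet_derivative f (at x) i * g x) U"
      using Suc.IH[of f "partial_deriv i g"] Suc.IH[of "partial_deriv i f" g] 
        Suc.prems C_k_on_SucD[OF Suc.prems(1)] C_k_on_SucD[OF Suc.prems(2)] C_k_on_add[OF assms(1)]
      by (simp add: partial_deriv_def[abs_def])
  qed
qed (auto intro: continuous_on_mult)

lemma C_k_on_cmult: "open U \<Longrightarrow> C_k_on k f U \<Longrightarrow> C_k_on k (\<lambda>x. c * f x) U"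
  by (intro C_k_on_mult C_k_on_const)

lemma C_k_on_diff: "open U \<Longrightarrow> C_k_on k f U \<Longrightarrow> C_k_on k g U \<Longrightarrow> C_k_on k (\<lambda>x. f x - g x) U"
  using C_k_on_add[of U k f "\<lambda>x. -1 * g x"] C_k_on_cmult[of U k g "-1"] by simp

lemma C_k_on_sum:
  "open U \<Longrightarrow> (\<And>i. i \<in> I \<Longrightarrow> C_k_on k (f i) U) \<Longrightarrow> C_k_on k (\<lambda>x. \<Sum>i\<in>I. f i x) U"
  by (induction I rule: infinite_finite_induct) (auto intro: C_k_on_const C_k_on_add)

lemma C_k_on_real_SucI:
  fixes h :: "real \<Rightarrow> real"
  assumes "open I" "\<And>x. x \<in> I \<Longrightarrow> (h has_real_derivative h' x) (at x)" "C_k_on k h' I"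
  shows "C_k_on (Suc k) h I"
  by (rule C_k_on_SucI[OF assms(1), of h "\<lambda>x t. h' x * t"])
     (use assms in \<open>auto simp: has_field_derivative_def\<close>)

lemma C_k_on_real_SucD:
  fixes h :: "real \<Rightarrow> real"
  assumes "open I" "C_k_on (Suc k) h I"
  shows "x \<in> I \<Longrightarrow> (h has_real_derivative deriv h x) (at x)" "C_k_on k (deriv h) I"
proof -
  show *: "(h has_real_derivative deriv h x) (at x)" if "x \<in> I" for x
    using assms that by (auto simp: DERIV_deriv_iff_real_differentiable)
  show "C_k_on k (deriv h) I"
  proof (rule C_k_on_cong[OF assms(1)])
    show "C_k_on k (partial_deriv 1 h) I" using assms(2) by simp
    show "partial_deriv 1 h y = deriv h y" if "y \<in> I" for y
      using partial_deriv_eq[OF *[OF that, unfolded has_field_derivative_def]] by simp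
  qed
qed

lemma C_k_on_compose:
  fixes h :: "real \<Rightarrow> real" and q :: "'a::euclidean_space \<Rightarrow> real"
  assumes "open U" "open I" "q ` U \<subseteq> I" "C_k_on k q U" "C_k_on k h I"
  shows "C_k_on k (\<lambda>x. h (q x)) U"
  using assms(4,5)
proof (induction k arbitrary: h)
  case 0 then show ?case using assms(3) by (auto intro: continuous_on_compose2)
next
  case (Suc k)
  show ?case
  proof (rule C_k_on_SucI[OF assms(1)])
    fix x assume "x \<in> U"
    then show "((\<lambda>x. h (q x)) has_derivative (\<lambda>t. deriv h (q x) * frechet_derivative q (at x) t)) (at x)"
      using Suc.prems assms(3) C_k_on_real_SucD(1)[OF assms(2) Suc.prems(2), of "q x"]
      by (auto intro!: has_derivative_compose[OF has_derivative_partial] simp: has_field_derivative_def)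
  next
    fix i :: 'a assume i: "i \<in> Basis"
    have "C_k_on k (\<lambda>x. deriv h (q x)) U"
      using Suc.IH C_k_on_SucD Suc.prems C_k_on_real_SucD(2)[OF assms(2)] by blast
    then show "C_k_on k (\<lambda>x. deriv h (q x) * frechet_derivative q (at x) i) U"
      using C_k_on_mult[OF assms(1)] Suc.prems(1) i by (simp add: partial_deriv_def[abs_def])
  qed
qed

lemma C_k_on_inner: "open U \<Longrightarrow> C_k_on k (\<lambda>x. (x - a) \<bullet> b) U"
proof (cases k)
  case (Suc j)
  assume "open U"
  then show ?thesis unfolding Suc
    by (rule C_k_on_SucI[where f' = "\<lambda>x h. h \<bullet> b"])
       (auto intro!: derivative_eq_intros C_k_on_const)
qed (auto intro!: continuous_intros)

lemma C_k_on_norm_sq: "open U \<Longrightarrow> C_k_on k (\<lambda>x. c * (norm (x - a))\<^sup>2) U"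
proof (cases k)
  case (Suc j)
  assume o: "open U"
  then show ?thesis unfolding Suc
    apply (rule C_k_on_SucI[where f' = "\<lambda>x h. 2 * c * ((x - a) \<bullet> h)"])
     apply (simp add: power2_norm_eq_inner) 
     apply (auto intro!: derivative_eq_intros simp: algebra_simps inner_commute)[1]
    by (intro C_k_on_cmult o C_k_on_inner)
qed (auto intro!: continuous_intros)

lemma C_k_on_laplacian:
  assumes "open U" "C_k_on (Suc (Suc k)) f U"
  shows "C_k_on k (laplacian f) U"
  using C_k_on_sum[OF assms(1), of Basis k "\<lambda>i. partial_deriv i (partial_deriv i f)"] assms(2)
  by (simp add: laplacian_def[abs_def])

lemma C_k_on_laplacian_funpow:
  assumes "open U" "C_k_on (k + 2 * j) f U"
  shows "C_k_on k ((laplacian ^^ j) f) U"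
  using assms(2)
proof (induction j arbitrary: k)
  case (Suc j)
  have "C_k_on (Suc (Suc k) + 2 * j) f U" using Suc.prems by simp
  from C_k_on_laplacian[OF assms(1) Suc.IH[OF this]] show ?case by simp
qed simp

section \<open>The Laplacian on radial functions\<close>

text \<open>The Laplacian in dimension \<open>d\<close> acting on profiles in the variable s =
  |x|^2. With the squared norm instead of the norm, a smooth profile gives a smooth function at the
  center and no division by the radius occurs.\<close>

definition radial_op :: "real \<Rightarrow> (real \<Rightarrow> real) \<Rightarrow> real \<Rightarrow> real" where
  "radial_op d h s = 4 * s * deriv (deriv h) s + 2 * d * deriv h s"

lemma deriv_cong_open:
  fixes f g :: "real \<Rightarrow> real"
  assumes "open I" "x \<in> I" "\<And>y. y \<in> I \<Longrightarrow> f y = g y"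
  shows "deriv f x = deriv g x"
  by (rule deriv_cong_ev) (use assms in \<open>auto simp: eventually_nhds\<close>)

lemma radial_op_eq:
  assumes "open I" "s \<in> I" "\<And>t. t \<in> I \<Longrightarrow> (h has_real_derivative h1 t) (at t)"
    "(h1 has_real_derivative h2) (at s)"
  shows "radial_op d h s = 4 * s * h2 + 2 * d * h1 s"
proof -
  have 1: "deriv h t = h1 t" if "t \<in> I" for t using assms(3)[OF that] by (rule DERIV_imp_deriv)
  have "deriv (deriv h) s = deriv h1 s" by (rule deriv_cong_open[OF assms(1,2) 1])
  also have "\<dots> = h2" using assms(4) by (rule DERIV_imp_deriv)
  finally show ?thesis using 1[OF assms(2)] by (simp add: radial_op_def)
qed

lemma radial_op_cong:
  assumes "open I" "s \<in> I" "\<And>t. t \<in> I \<Longrightarrow> f t = g t"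
  shows "radial_op d f s = radial_op d g s"
  unfolding radial_op_def
  using deriv_cong_open[OF assms(1,2), of f g] deriv_cong_open[OF assms(1,2), of "deriv f" "deriv g"]
    deriv_cong_open[OF assms(1), of _ f g] assms(3) by simp

lemma radial_op_funpow_cong:
  assumes "open I" "s \<in> I" "\<And>t. t \<in> I \<Longrightarrow> f t = g t"
  shows "(radial_op d ^^ k) f s = (radial_op d ^^ k) g s"
  using assms(2)
proof (induction k arbitrary: s)
  case (Suc k)
  show ?case using radial_op_cong[OF assms(1) Suc.prems Suc.IH] by simp
qed (use assms in simp)

lemma C_k_on_radial_op:
  assumes "open I" "C_k_on (Suc (Suc k)) h I"
  shows "C_k_on k (radial_op d h) I"
proof -
  have 1: "C_k_on (Suc k) (deriv h) I" and 2: "C_k_on k (deriv (deriv h)) I"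
    using C_k_on_real_SucD(2)[OF assms(1)] assms(2) by blast+
  have "C_k_on k (\<lambda>s::real. s) I"
    using C_k_on_inner[OF assms(1), of k 0 1] by simp
  then show ?thesis unfolding radial_op_def[abs_def]
    by (intro C_k_on_add C_k_on_mult assms(1) C_k_on_const 2 C_k_on_SucD[OF 1])
qed

lemma C_k_on_radial_op_funpow:
  assumes "open I" "C_k_on (k + 2 * j) h I"
  shows "C_k_on k ((radial_op d ^^ j) h) I"
  using assms(2)
proof (induction j arbitrary: k)
  case (Suc j)
  have "C_k_on (Suc (Suc k) + 2 * j) h I" using Suc.prems by simp
  from C_k_on_radial_op[OF assms(1) Suc.IH[OF this]] show ?case by simp
qed simp

lemma radial_op_lincomb:
  assumes "open I" "C_k_on 2 f I" "C_k_on 2 g I" "s \<in> I"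
  shows "radial_op d (\<lambda>t. a * f t + b * g t) s = a * radial_op d f s + b * radial_op d g s"
proof -
  have f: "C_k_on (Suc 1) f I" and g: "C_k_on (Suc 1) g I" using assms(2,3) by (simp_all add: numeral_2_eq_2)
  note f1 = C_k_on_real_SucD[OF assms(1) f] and g1 = C_k_on_real_SucD[OF assms(1) g]
  note f2 = C_k_on_real_SucD(1)[OF assms(1) f1(2)[unfolded One_nat_def]]
    and g2 = C_k_on_real_SucD(1)[OF assms(1) g1(2)[unfolded One_nat_def]]
  have "radial_op d (\<lambda>t. a * f t + b * g t) s =
      4 * s * (a * deriv (deriv f) s + b * deriv (deriv g) s) + 2 * d * (a * deriv f s + b * deriv g s)"
    by (intro radial_op_eq[OF assms(1,4)] DERIV_add DERIV_cmult f1(1) g1(1) f2 g2 assms(4))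
  then show ?thesis by (simp add: radial_op_def algebra_simps)
qed

lemma radial_op_funpow_lincomb:
  assumes "open I" "C_k_on (2 * k) f I" "C_k_on (2 * k) g I" "s \<in> I"
  shows "(radial_op d ^^ k) (\<lambda>t. a * f t + b * g t) s
    = a * (radial_op d ^^ k) f s + b * (radial_op d ^^ k) g s"
  using assms(2-4)
proof (induction k arbitrary: s)
  case (Suc k)
  have c: "C_k_on (2 * k) f I" "C_k_on (2 * k) g I"
    by (rule C_k_on_le[OF Suc.prems(1)] C_k_on_le[OF Suc.prems(2)]; simp)+
  have "(radial_op d ^^ Suc k) (\<lambda>t. a * f t + b * g t) s
      = radial_op d (\<lambda>t. a * (radial_op d ^^ k) f t + b * (radial_op d ^^ k) g t) s"
    unfolding funpow.simps o_apply by (rule radial_op_cong[OF assms(1) Suc.prems(3) Suc.IH[OF c]])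
  also have "\<dots> = a * (radial_op d ^^ Suc k) f s + b * (radial_op d ^^ Suc k) g s"
    unfolding funpow.simps o_apply using Suc.prems
    by (intro radial_op_lincomb[OF assms(1) _ _ Suc.prems(3)] C_k_on_radial_op_funpow assms(1)) auto
  finally show ?case .
qed simp

lemma radial_op_funpow_sum:
  assumes "open I" "\<And>j. j \<in> J \<Longrightarrow> C_k_on (2 * k) (f j) I" "s \<in> I" "finite J"
  shows "(radial_op d ^^ k) (\<lambda>t. \<Sum>j\<in>J. c j * f j t) s = (\<Sum>j\<in>J. c j * (radial_op d ^^ k) (f j) s)"
  using assms(4,2)
proof (induction J)
  case empty
  have "(radial_op d ^^ k) (\<lambda>t. 0 * 0 + 0 * 0) s = 0"
    using radial_op_funpow_lincomb[OF assms(1) C_k_on_const[of _ 0] C_k_on_const[of _ 0] assms(3), where d = d and k = k and a = 0 and b = 0]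
    by simp
  then show ?case by simp
next
  case (insert j J)
  have "(radial_op d ^^ k) (\<lambda>t. c j * f j t + 1 * (\<Sum>j\<in>J. c j * f j t)) s
    = c j * (radial_op d ^^ k) (f j) s + 1 * (radial_op d ^^ k) (\<lambda>t. \<Sum>j\<in>J. c j * f j t) s"
    by (rule radial_op_funpow_lincomb[OF assms(1) _ _ assms(3)])
       (use insert.prems in \<open>auto intro!: C_k_on_sum C_k_on_cmult assms(1)\<close>)
  then show ?case using insert by simp
qed

lemma open_radial_preimage: "open I \<Longrightarrow> open {y::'a::euclidean_space. c * (norm (y - a))\<^sup>2 \<in> I}"
  for I :: "real set"
proof -
  assume "open I"
  then have "open ((\<lambda>y::'a. c * (norm (y - a))\<^sup>2) -` I)"
    by (rule open_vimage) (intro continuous_intros)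
  then show ?thesis by (simp add: vimage_def)
qed

lemma C_k_on_radial:
  assumes "open I" "C_k_on k h I" "open U" "\<And>y. y \<in> U \<Longrightarrow> c * (norm (y - a))\<^sup>2 \<in> I"
  shows "C_k_on k (\<lambda>y::'a::euclidean_space. h (c * (norm (y - a))\<^sup>2)) U"
  by (rule C_k_on_compose[OF assms(3,1) _ C_k_on_norm_sq[OF assms(3)] assms(2)]) (use assms in auto)

text \<open>By the chain rule the second derivative of the profile collects 4 c^2 |x-a|^2, that is 4
  c times the argument, and the first derivative collects 2 c once per dimension. One factor
  \<open>c\<close> therefore splits off.\<close>

lemma laplacian_radial:
  fixes a x :: "'a::euclidean_space"
  assumes I: "open I" and h: "C_k_on 2 h I" and x: "c * (norm (x - a))\<^sup>2 \<in> I"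
  shows "laplacian (\<lambda>y. h (c * (norm (y - a))\<^sup>2)) x
    = c * radial_op (real DIM('a)) h (c * (norm (x - a))\<^sup>2)"
proof -
  define q where "q y = c * (norm (y - a))\<^sup>2" for y :: 'a
  define W where "W = {y. q y \<in> I}"
  have W: "open W" "x \<in> W" using open_radial_preimage[OF I, of c a] x by (auto simp: W_def q_def)
  have h': "C_k_on (Suc 1) h I" using h by (simp add: numeral_2_eq_2)
  note h1 = C_k_on_real_SucD[OF I h']
  note h2 = C_k_on_real_SucD(1)[OF I h1(2)[unfolded One_nat_def]]
  have q: "(q has_derivative (\<lambda>h. 2 * c * ((y - a) \<bullet> h))) (at y)" for y
    unfolding q_def power2_norm_eq_inner
    by (auto intro!: derivative_eq_intros simp: algebra_simps inner_commute)
  have p1: "partial_deriv i (\<lambda>y. h (q y)) y = deriv h (q y) * (2 * c * ((y - a) \<bullet> i))" if "y \<in> W" for y i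
    by (rule partial_deriv_eq[OF has_derivative_compose[OF q]])
       (use h1(1) that in \<open>auto simp: has_field_derivative_def W_def\<close>)
  have p2: "partial_deriv i (partial_deriv i (\<lambda>y. h (q y))) x
      = 4 * c\<^sup>2 * deriv (deriv h) (q x) * ((x - a) \<bullet> i)\<^sup>2 + 2 * c * deriv h (q x)" if i: "i \<in> Basis" for i
  proof -
    have "((\<lambda>y. deriv h (q y)) has_derivative (\<lambda>t. deriv (deriv h) (q x) * (2 * c * ((x - a) \<bullet> t)))) (at x)"
      by (rule has_derivative_compose[OF q]) (use h2 W in \<open>auto simp: has_field_derivative_def W_def\<close>)
    moreover have "((\<lambda>y. 2 * c * ((y - a) \<bullet> i)) has_derivative (\<lambda>t. 2 * c * (t \<bullet> i))) (at x)"
      by (auto intro!: derivative_eq_intros)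
    ultimately have "((\<lambda>y. deriv h (q y) * (2 * c * ((y - a) \<bullet> i))) has_derivative
        (\<lambda>t. deriv h (q x) * (2 * c * (t \<bullet> i)) + deriv (deriv h) (q x) * (2 * c * ((x - a) \<bullet> t)) * (2 * c * ((x - a) \<bullet> i)))) (at x)"
      by (rule has_derivative_mult)
    from partial_deriv_eq[OF this, of i]
    have "partial_deriv i (\<lambda>y. deriv h (q y) * (2 * c * ((y - a) \<bullet> i))) x
      = deriv h (q x) * (2 * c * (i \<bullet> i)) + deriv (deriv h) (q x) * (2 * c * ((x - a) \<bullet> i)) * (2 * c * ((x - a) \<bullet> i))" .
    also have "\<dots> = 4 * c\<^sup>2 * deriv (deriv h) (q x) * ((x - a) \<bullet> i)\<^sup>2 + 2 * c * deriv h (q x)"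
      using i by (simp add: power2_eq_square)
    finally have "partial_deriv i (\<lambda>y. deriv h (q y) * (2 * c * ((y - a) \<bullet> i))) x
      = 4 * c\<^sup>2 * deriv (deriv h) (q x) * ((x - a) \<bullet> i)\<^sup>2 + 2 * c * deriv h (q x)" .
    moreover have "partial_deriv i (partial_deriv i (\<lambda>y. h (q y))) x
      = partial_deriv i (\<lambda>y. deriv h (q y) * (2 * c * ((y - a) \<bullet> i))) x"
      by (rule partial_deriv_cong[OF W]) (rule p1)
    ultimately show ?thesis by simp
  qed
  have n: "(norm (x - a))\<^sup>2 = (\<Sum>i\<in>Basis. ((x - a) \<bullet> i)\<^sup>2)"
    unfolding power2_norm_eq_inner euclidean_inner[of "x - a" "x - a"] by (simp add: power2_eq_square)
  have "laplacian (\<lambda>y. h (q y)) x = 4 * c\<^sup>2 * deriv (deriv h) (q x) * (norm (x - a))\<^sup>2 + real DIM('a) * (2 * c * deriv h (q x))"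
    unfolding laplacian_def n by (simp add: p2 sum.distrib sum_distrib_left)
  then show ?thesis by (simp add: radial_op_def q_def[abs_def] algebra_simps power2_eq_square)
qed

lemma laplacian_funpow_radial:
  fixes a x :: "'a::euclidean_space"
  assumes I: "open I" and h: "C_k_on (2 * k) h I" and x: "c * (norm (x - a))\<^sup>2 \<in> I"
  shows "(laplacian ^^ k) (\<lambda>y. h (c * (norm (y - a))\<^sup>2)) x
    = c ^ k * (radial_op (real DIM('a)) ^^ k) h (c * (norm (x - a))\<^sup>2)"
  using h x
proof (induction k arbitrary: x)
  case (Suc k)
  let ?W = "{y. c * (norm (y - a))\<^sup>2 \<in> I}"
  let ?L = "radial_op (real DIM('a))"
  let ?g = "\<lambda>t. c ^ k * (?L ^^ k) h t"
  have c0: "C_k_on (2 * k) h I"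
    by (rule C_k_on_le[OF Suc.prems(1)]) simp
  have c2: "C_k_on 2 ((?L ^^ k) h) I"
    by (rule C_k_on_radial_op_funpow[OF I]) (use Suc.prems in auto)
  have "(laplacian ^^ Suc k) (\<lambda>y. h (c * (norm (y - a))\<^sup>2)) x = laplacian (\<lambda>y. ?g (c * (norm (y - a))\<^sup>2)) x"
    unfolding funpow.simps o_apply
    by (rule laplacian_cong[OF open_radial_preimage[OF I]]) (use Suc c0 in auto)
  also have "\<dots> = c * ?L ?g (c * (norm (x - a))\<^sup>2)"
    by (rule laplacian_radial[OF I C_k_on_cmult[OF I c2] Suc.prems(2)])
  also have "?L ?g (c * (norm (x - a))\<^sup>2) = c ^ k * (?L ^^ Suc k) h (c * (norm (x - a))\<^sup>2)"
    using radial_op_lincomb[OF I c2 c2 Suc.prems(2), of "real DIM('a)" "c ^ k" 0] by simp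
  finally show ?case by simp
qed simp

section \<open>Integration by parts\<close>

lemma integrable_compact_support:
  fixes f :: "'a::euclidean_space \<Rightarrow> real"
  assumes "continuous_on UNIV f" "\<And>x. r < norm x \<Longrightarrow> f x = 0"
  shows "integrable lborel f"
proof -
  have "integrable lborel (\<lambda>x. indicator (cball 0 r) x *\<^sub>R f x)"
    by (rule borel_integrable_compact) (use assms(1) in \<open>auto intro: continuous_on_subset\<close>)
  also have "(\<lambda>x. indicator (cball 0 r) x *\<^sub>R f x) = f"
    using assms(2) by (auto simp: indicator_def fun_eq_iff not_le)
  finally show ?thesis .
qed

lemma open_norm_greater: "open {x::'a::real_normed_vector. r < norm x}"
  by (intro open_Collect_less continuous_intros)

lemma partial_deriv_eq_0:
  assumes "open U" "x \<in> U" "\<And>y. y \<in> U \<Longrightarrow> f y = 0"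
  shows "partial_deriv i f x = 0"
proof -
  have "partial_deriv i f x = partial_deriv i (\<lambda>x. 0) x"
    using assms by (intro partial_deriv_cong[of U]) auto
  also have "\<dots> = 0" by (rule partial_deriv_eq) auto
  finally show ?thesis .
qed

lemma laplacian_eq_0:
  assumes "open U" "x \<in> U" "\<And>y. y \<in> U \<Longrightarrow> f y = 0"
  shows "laplacian f x = 0"
  unfolding laplacian_def
  by (intro sum.neutral ballI partial_deriv_eq_0[OF assms(1,2)] partial_deriv_eq_0[OF assms(1) _ assms(3)])

lemma laplacian_funpow_eq_0:
  assumes "open U" "x \<in> U" "\<And>y. y \<in> U \<Longrightarrow> f y = 0"
  shows "(laplacian ^^ k) f x = 0"
  using assms(2)
proof (induction k arbitrary: x)
  case (Suc k)
  show ?case using laplacian_eq_0[OF assms(1) Suc.prems Suc.IH] by simp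
qed (use assms in simp)

lemma integral_lborel_translate:
  fixes f :: "'a::euclidean_space \<Rightarrow> real"
  assumes [measurable]: "f \<in> borel_measurable borel"
  shows "(LINT x|lborel. f (x + c)) = (LINT x|lborel. f x)"
proof -
  have "(LINT x|lborel. f x) = (LINT x|distr lborel borel ((+) c). f x)"
    by (simp add: lborel_distr_plus)
  also have "\<dots> = (LINT x|lborel. f (c + x))" by (rule integral_distr) auto
  finally show ?thesis by (simp add: add.commute)
qed

text \<open>By translation invariance every difference quotient has integral zero. The mean value
  theorem bounds the quotients by the maximum of the derivative, and dominated convergence carries
  the value zero to the limit.\<close>

lemma integral_partial_deriv_eq_0:
  fixes F :: "'a::euclidean_space \<Rightarrow> real"
  assumes F: "C_k_on 1 F UNIV" and supp: "\<And>x. r < norm x \<Longrightarrow> F x = 0" and i: "i \<in> Basis"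
  shows "(LINT x|lborel. partial_deriv i F x) = 0"
proof -
  let ?D = "partial_deriv i F"
  have Dc: "continuous_on UNIV ?D" using F i by (simp add: One_nat_def)
  have Fc: "continuous_on UNIV F" using F by (rule C_k_on_imp_continuous)
  have D0: "?D x = 0" if "r < norm x" for x
    by (rule partial_deriv_eq_0[OF open_norm_greater[of r]]) (use that supp in auto)
  have "bounded (?D ` cball 0 r)"
    by (intro compact_imp_bounded compact_continuous_image continuous_on_subset[OF Dc]) auto
  then obtain B0 where B0: "\<forall>x\<in>cball 0 r. \<bar>?D x\<bar> \<le> B0"
    by (auto simp: bounded_iff)
  define B where "B = max B0 0"
  have B: "\<bar>?D x\<bar> \<le> B" for x
    using bspec[OF B0, of x] D0[of x] by (cases "r < norm x") (auto simp: B_def)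
  have der: "((\<lambda>t. F (x + t *\<^sub>R i)) has_real_derivative ?D (x + t *\<^sub>R i)) (at t)" for x t
  proof -
    have dF: "(F has_derivative (\<lambda>h. frechet_derivative F (at y) h)) (at y)" for y
      using F by (intro has_derivative_partial) (simp add: One_nat_def)
    have "((\<lambda>t. F (x + t *\<^sub>R i)) has_derivative (\<lambda>s. frechet_derivative F (at (x + t *\<^sub>R i)) (s *\<^sub>R i))) (at t)"
      by (rule has_derivative_compose[OF _ dF]) (auto intro!: derivative_eq_intros)
    moreover have "frechet_derivative F (at y) (s *\<^sub>R i) = ?D y * s" for s y
      using linear_scale[OF has_derivative_linear[OF dF]] by (simp add: partial_deriv_def)
    ultimately show ?thesis by (simp add: has_field_derivative_def)
  qed
  define s where "s k x = (F (x + (1 / real (Suc k)) *\<^sub>R i) - F x) * real (Suc k)" for k :: nat and x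
  have Fm [measurable]: "F \<in> borel_measurable borel" using Fc by (rule borel_measurable_continuous_onI)
  have Dm [measurable]: "?D \<in> borel_measurable borel" using Dc by (rule borel_measurable_continuous_onI)
  have Fi: "integrable lborel F" by (rule integrable_compact_support[OF Fc supp])
  have Ft: "integrable lborel (\<lambda>x. F (x + c))" for c
    by (rule integrable_compact_support[where r = "r + norm c"])
       (auto intro!: continuous_on_compose2[OF Fc] continuous_intros supp
         dest: norm_triangle_lt[of _ "-c"] simp: norm_minus_cancel,
        metis add.commute add_diff_cancel_right' less_le_trans norm_triangle_ineq4 not_less supp diff_less_eq)
  have s0: "(LINT x|lborel. s k x) = 0" for k
    unfolding s_def using Fi Ft integral_lborel_translate[OF Fm] by simp
  have lim: "(\<lambda>k. LINT x|lborel. s k x) \<longlonglongrightarrow> (LINT x|lborel. ?D x)"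
  proof (rule integral_dominated_convergence)
    \<comment> \<open>The shifts have length at most 1, so all quotients vanish outside the ball of
      radius \<open>r + 1\<close>.\<close>
    show "integrable lborel (\<lambda>x. B * indicator (cball 0 (r + 1)) x :: real)"
      by (intro integrable_mult_right integrable_real_indicator) (simp_all add: emeasure_lborel_cball_finite[unfolded infinity_ennreal_def])
    show "AE x in lborel. (\<lambda>k. s k x) \<longlonglongrightarrow> ?D x"
    proof (intro AE_I2)
      fix x
      have "(\<lambda>h. (F (x + (0 + h) *\<^sub>R i) - F (x + 0 *\<^sub>R i)) / h) \<midarrow>0\<rightarrow> ?D (x + 0 *\<^sub>R i)"
        by (rule DERIV_D[OF der])
      moreover have "filterlim (\<lambda>k. 1 / real (Suc k)) (at 0) sequentially"
        using LIMSEQ_Suc[OF lim_1_over_n[where 'a = real]] by (auto simp: filterlim_at)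
      ultimately have "(\<lambda>k. (F (x + (0 + 1 / real (Suc k)) *\<^sub>R i) - F (x + 0 *\<^sub>R i)) / (1 / real (Suc k)))
          \<longlonglongrightarrow> ?D (x + 0 *\<^sub>R i)"
        by (rule filterlim_compose)
      then show "(\<lambda>k. s k x) \<longlonglongrightarrow> ?D x" by (simp add: s_def[abs_def])
    qed
    show "AE x in lborel. norm (s k x) \<le> B * indicator (cball 0 (r + 1)) x" for k
    proof (intro AE_I2)
      fix x :: 'a
      let ?t = "1 / real (Suc k)"
      show "norm (s k x) \<le> B * indicator (cball 0 (r + 1)) x"
      proof (cases "norm x \<le> r + 1")
        case True
        obtain z where "F (x + ?t *\<^sub>R i) - F (x + 0 *\<^sub>R i) = (?t - 0) * ?D (x + z *\<^sub>R i)"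
          using MVT2[of 0 ?t "\<lambda>t. F (x + t *\<^sub>R i)" "\<lambda>t. ?D (x + t *\<^sub>R i)"] der by auto
        then have "s k x = ?D (x + z *\<^sub>R i)" by (simp add: s_def)
        then show ?thesis using True B by simp
      next
        case False
        have "norm (?t *\<^sub>R i) \<le> 1" using i by (simp add: norm_Basis)
        then have "r < norm (x + ?t *\<^sub>R i)"
          using False norm_triangle_ineq4[of "x + ?t *\<^sub>R i" "?t *\<^sub>R i"]
          unfolding add_diff_cancel_right' by linarith
        then show ?thesis using False supp by (simp add: s_def)
      qed
    qed
  qed (auto simp: s_def)
  show ?thesis using LIMSEQ_unique[OF lim] s0 by simp
qed

text \<open>Green's second identity: the difference of the integrands is the divergence of the field
  with components \<open>?F i\<close>, which is compactly supported because \<open>w\<close> is;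
  \<open>u\<close> may be arbitrary at infinity.\<close>

lemma integral_laplacian_symmetric:
  fixes u w :: "'a::euclidean_space \<Rightarrow> real"
  assumes u: "C_k_on 2 u UNIV" and w: "C_k_on 2 w UNIV" and supp: "\<And>x. r < norm x \<Longrightarrow> w x = 0"
  shows "(LINT x|lborel. u x * laplacian w x) = (LINT x|lborel. laplacian u x * w x)"
proof -
  let ?F = "\<lambda>i x. u x * partial_deriv i w x - partial_deriv i u x * w x"
  have u': "C_k_on (Suc 1) u UNIV" and w': "C_k_on (Suc 1) w UNIV" using u w by (simp_all add: numeral_2_eq_2)
  have u1: "C_k_on 1 u UNIV" and w1: "C_k_on 1 w UNIV" using C_k_on_SucD[OF u'] C_k_on_SucD[OF w'] by auto
  have dw0: "partial_deriv i w x = 0" if "r < norm x" for x i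
    by (rule partial_deriv_eq_0[OF open_norm_greater[of r]]) (use that supp in auto)
  have lw0: "laplacian w x = 0" if "r < norm x" for x
    by (rule laplacian_eq_0[OF open_norm_greater[of r]]) (use that supp in auto)
  have du: "C_k_on 1 (partial_deriv i u) UNIV" and dw: "C_k_on 1 (partial_deriv i w) UNIV" if "i \<in> Basis" for i
    using u' w' that by auto
  have F1: "C_k_on 1 (?F i) UNIV" if "i \<in> Basis" for i
    by (intro C_k_on_diff C_k_on_mult u1 w1 du dw that open_UNIV)
  have dF: "partial_deriv i (?F i) x = u x * partial_deriv i (partial_deriv i w) x - partial_deriv i (partial_deriv i u) x * w x"
    if i: "i \<in> Basis" for i x
  proof -
    have d: "(g has_derivative (\<lambda>h. frechet_derivative g (at x) h)) (at x)" if "C_k_on 1 g UNIV" for g :: "'a \<Rightarrow> real"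
      using that by (intro has_derivative_partial) (simp add: One_nat_def)
    show ?thesis
      using partial_deriv_eq[OF has_derivative_diff[OF has_derivative_mult[OF d[OF u1] d[OF dw[OF i]]]
            has_derivative_mult[OF d[OF du[OF i]] d[OF w1]]], of i]
      by (simp add: partial_deriv_def)
  qed
  have I: "integrable lborel (partial_deriv i (?F i))" if "i \<in> Basis" for i
  proof (rule integrable_compact_support[where r = r])
    show "continuous_on UNIV (partial_deriv i (?F i))" using F1[OF that] that by (simp add: One_nat_def)
    show "partial_deriv i (?F i) x = 0" if "r < norm x" for x
      by (rule partial_deriv_eq_0[OF open_norm_greater[of r]]) (use that supp dw0 in auto)
  qed
  have cu: "continuous_on UNIV (laplacian u)" and cw: "continuous_on UNIV (laplacian w)"
    using C_k_on_laplacian[of UNIV 0] u w by (auto simp: numeral_2_eq_2)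
  have "(LINT x|lborel. u x * laplacian w x - laplacian u x * w x) = (LINT x|lborel. (\<Sum>i\<in>Basis. partial_deriv i (?F i) x))"
    by (intro Bochner_Integration.integral_cong refl)
       (simp add: dF laplacian_def sum_subtractf sum_distrib_left sum_distrib_right)
  also have "\<dots> = (\<Sum>i\<in>Basis. LINT x|lborel. partial_deriv i (?F i) x)"
    using I by (rule Bochner_Integration.integral_sum)
  also have "\<dots> = 0"
    by (intro sum.neutral ballI integral_partial_deriv_eq_0[where r = r] F1) (use supp dw0 in auto)
  finally have "(LINT x|lborel. u x * laplacian w x - laplacian u x * w x) = 0" .
  moreover have "integrable lborel (\<lambda>x. u x * laplacian w x)" "integrable lborel (\<lambda>x. laplacian u x * w x)"
    by (rule integrable_compact_support[where r = r];
        use cu cw C_k_on_imp_continuous[OF u] C_k_on_imp_continuous[OF w] supp lw0 in \<open>auto intro!: continuous_intros\<close>)+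
  ultimately show ?thesis by simp
qed

text \<open>The innermost Laplacian is left on \<open>w\<close>, so the induction hypothesis is
  applied to the test function \<open>laplacian w\<close>; the last Laplacian is then moved by the
  second-order identity.\<close>

lemma integral_laplacian_funpow_symmetric:
  fixes u w :: "'a::euclidean_space \<Rightarrow> real"
  assumes "C_k_on (2 * k) u UNIV" "C_k_on (2 * k) w UNIV" "\<And>x. r < norm x \<Longrightarrow> w x = 0"
  shows "(LINT x|lborel. u x * (laplacian ^^ k) w x) = (LINT x|lborel. (laplacian ^^ k) u x * w x)"
  using assms
proof (induction k arbitrary: w)
  case (Suc k)
  have "(LINT x|lborel. u x * (laplacian ^^ Suc k) w x) = (LINT x|lborel. u x * (laplacian ^^ k) (laplacian w) x)"
    by (simp add: funpow_swap1)
  also have "\<dots> = (LINT x|lborel. (laplacian ^^ k) u x * laplacian w x)"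
  proof (rule Suc.IH)
    show "C_k_on (2 * k) u UNIV" by (rule C_k_on_le[OF Suc.prems(1)]) simp
    show "C_k_on (2 * k) (laplacian w) UNIV" by (rule C_k_on_laplacian) (use Suc.prems(2) in auto)
    show "laplacian w x = 0" if "r < norm x" for x
      by (rule laplacian_eq_0[OF open_norm_greater[of r]]) (use that Suc.prems in auto)
  qed
  also have "\<dots> = (LINT x|lborel. (laplacian ^^ Suc k) u x * w x)"
    unfolding funpow.simps o_apply
  proof (rule integral_laplacian_symmetric[OF _ _ Suc.prems(3)])
    show "C_k_on 2 ((laplacian ^^ k) u) UNIV"
      by (rule C_k_on_laplacian_funpow) (use Suc.prems(1) in auto)
    show "C_k_on 2 w UNIV" by (rule C_k_on_le[OF Suc.prems(2)]) simp
  qed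
  finally show ?case .
qed simp

section \<open>A regularized local fundamental solution\<close>

lemma DERIV_glue_zero:
  fixes f :: "real \<Rightarrow> real"
  assumes "(f has_real_derivative 0) (at c)" "f c = 0"
  shows "((\<lambda>t. if t < c then f t else 0) has_real_derivative 0) (at c)"
proof -
  let ?g = "\<lambda>t. if t < c then f t else 0"
  have "(\<lambda>h. (f (c + h) - f c) / h) \<midarrow>0\<rightarrow> 0" using DERIV_D[OF assms(1)] .
  then have lim: "(\<lambda>h. \<bar>(f (c + h) - f c) / h\<bar>) \<midarrow>0\<rightarrow> 0" by (rule tendsto_rabs_zero)
  \<comment> \<open>Each quotient of the glued function is either that of \<open>f\<close> or zero,
    hence dominated by the absolute quotient of \<open>f\<close>.\<close>
  have "(\<lambda>h. (?g (c + h) - ?g c) / h) \<midarrow>0\<rightarrow> 0"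
    by (rule Lim_null_comparison[OF _ lim]) (auto simp: assms(2))
  then show ?thesis by (simp add: DERIV_def)
qed

lemma DERIV_glue:
  fixes f f' :: "real \<Rightarrow> real"
  assumes "(f has_real_derivative f' t) (at t)" "f c = 0" "f' c = 0"
  shows "((\<lambda>t. if t < c then f t else 0) has_real_derivative (if t < c then f' t else 0)) (at t)"
proof (cases t c rule: linorder_cases)
  case less
  show ?thesis
    by (rule has_field_derivative_transform_within_open[of f _ _ "{..<c}"]) (use less assms in auto)
next
  case equal
  then show ?thesis using assms DERIV_glue_zero by fastforce
next
  case greater
  show ?thesis
    by (rule has_field_derivative_transform_within_open[of "\<lambda>t. 0" _ _ "{c<..}"]) (use greater in auto)
qed

lemma C_k_on_trunc_power: "C_k_on k (\<lambda>t::real. if t < 0 then (- t) ^ Suc k else 0) UNIV"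
proof (induction k)
  case 0
  have "(\<lambda>t::real. if t < 0 then (- t) ^ Suc 0 else 0) = (\<lambda>t. max 0 (- t))" by (auto simp: fun_eq_iff)
  then show ?case by (auto intro!: continuous_intros)
next
  case (Suc k)
  let ?g = "\<lambda>t::real. if t < 0 then (- t) ^ Suc k else 0"
  show ?case
  proof (rule C_k_on_real_SucI[OF open_UNIV _ C_k_on_cmult[OF open_UNIV Suc]])
    fix x :: real
    have "((\<lambda>t. if t < 0 then (- t) ^ Suc (Suc k) else 0) has_real_derivative
        (if x < 0 then - real (Suc (Suc k)) * (- x) ^ Suc k else 0)) (at x)"
      by (rule DERIV_glue) (auto intro!: derivative_eq_intros simp: algebra_simps simp del: power_Suc)
    then show "((\<lambda>t. if t < 0 then (- t) ^ Suc (Suc k) else 0) has_real_derivative - real (Suc (Suc k)) * ?g x) (at x)"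
      by (simp add: algebra_simps del: power_Suc split: if_splits)
  qed
qed

lemma DERIV_powr_shift:
  fixes e q s :: real
  assumes "- e < s"
  shows "((\<lambda>s. (s + e) powr q) has_real_derivative q * (s + e) powr (q - 1)) (at s)"
  using has_real_derivative_powr[of "s + e" q] assms DERIV_shift[of "\<lambda>z. z powr q" _ s e] by simp

text \<open>Only finitely many derivatives are required, so truncated powers can take the place of
  the exponential bump.\<close>

lemma smooth_cutoff_exists:
  obtains ct :: "real \<Rightarrow> real" where "C_k_on k ct UNIV" "\<And>t. 0 \<le> ct t" 
    "\<And>t. t \<le> 0 \<Longrightarrow> ct t = 0" "\<And>t. 1 \<le> t \<Longrightarrow> ct t = 1"
proof -
  define Q where "Q t = (if t < 0 then (- t) ^ Suc k else 0)" for t :: real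
  have Q: "C_k_on k Q UNIV" using C_k_on_trunc_power[of k] by (simp add: Q_def[abs_def])
  \<comment> \<open>The inner \<open>Q\<close> vanishes for t <= 0, where the outer one is Q(-1) =
    1. For t >= 1 the inner value is at least 1, so the outer \<open>Q\<close> sees a nonnegative
    argument and vanishes.\<close>
  define ct where "ct t = 1 - Q (Q (- 1 * t) - 1)" for t
  have m: "C_k_on k (\<lambda>t::real. - 1 * t) UNIV"
    using C_k_on_inner[of UNIV k 0 "-1 :: real"] by simp
  have "C_k_on k ct UNIV" unfolding ct_def
    by (intro C_k_on_diff C_k_on_const open_UNIV C_k_on_compose[OF _ open_UNIV _ _ Q] subset_UNIV m)
  moreover have "ct t = 0" if "t \<le> 0" for t
    using that by (simp add: ct_def Q_def)
  moreover have "ct t = 1" if "1 \<le> t" for t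
  proof -
    have "\<not> t ^ Suc k < 1" unfolding not_less using that by (rule one_le_power)
    then show ?thesis using that by (simp add: ct_def Q_def del: power_Suc)
  qed
  moreover have "0 \<le> ct t" for t
  proof -
    have "Q (s - 1) \<le> 1" if "0 \<le> s" for s
      using that power_le_one[of "- (s - 1)" "Suc k"] by (simp add: Q_def del: power_Suc)
    moreover have "0 \<le> Q s" for s by (simp add: Q_def del: power_Suc)
    ultimately show ?thesis by (simp add: ct_def)
  qed
  ultimately show ?thesis using that by blast
qed

section \<open>The regularized power truncated at s = 1\<close>

definition taylor_powr :: "real \<Rightarrow> real \<Rightarrow> nat \<Rightarrow> real \<Rightarrow> real" where
  "taylor_powr p e N s = (\<Sum>j<N. (pochhammer p j / fact j * (1 + e) powr (- p - j)) * (1 - s) ^ j)"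

text \<open>\<open>taylor_powr p e N\<close> is the Taylor polynomial of (s+e)^(-p) at s = 1 with
  \<open>N\<close> terms. It is expanded in powers of 1 - s because then all coefficients are
  nonnegative for p > 0. Subtracting it makes the kernel vanish to order \<open>N\<close> at 1, so
  that continuation by zero costs only one order of smoothness.\<close>

definition kern :: "real \<Rightarrow> real \<Rightarrow> nat \<Rightarrow> real \<Rightarrow> real" where
  "kern p e N s = (if s < 1 then (s + e) powr (- p) - taylor_powr p e N s else 0)"

text \<open>Since \<open>pochhammer p (Suc j)\<close> is p times
  \<open>pochhammer (p + 1) j\<close>, the polynomial obeys the differentiation rule of the power
  itself: p moves to p + 1 and one term is lost. This makes \<open>kern\<close> closed under
  differentiation.\<close>

lemma DERIV_taylor_powr:
  "(taylor_powr p e (Suc N) has_real_derivative - p * taylor_powr (p + 1) e N s) (at s)"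
proof -
  let ?a = "\<lambda>j::nat. pochhammer p j / fact j * (1 + e) powr (- p - j)"
  have "((\<lambda>s. ?a 0 + (\<Sum>j<N. ?a (Suc j) * (1 - s) ^ Suc j)) has_real_derivative
      (\<Sum>j<N. ?a (Suc j) * (- real (Suc j) * (1 - s) ^ j))) (at s)"
  proof -
    have "((\<lambda>s. (1 - s) ^ Suc j) has_real_derivative - real (Suc j) * (1 - s) ^ j) (at s)" for j
      by (auto intro!: derivative_eq_intros simp: algebra_simps simp del: power_Suc)
    from DERIV_add[OF DERIV_const DERIV_sum[OF DERIV_cmult[OF this]]] show ?thesis
      unfolding add_0 .
  qed
  also have "(\<lambda>s. ?a 0 + (\<Sum>j<N. ?a (Suc j) * (1 - s) ^ Suc j)) = taylor_powr p e (Suc N)"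
    by (rule ext) (simp only: taylor_powr_def sum.lessThan_Suc_shift power_0 mult_1_right)
  also have "(\<Sum>j<N. ?a (Suc j) * (- real (Suc j) * (1 - s) ^ j)) = - p * taylor_powr (p + 1) e N s"
    unfolding taylor_powr_def sum_distrib_left
  proof (rule sum.cong[OF refl])
    fix j
    show "?a (Suc j) * (- real (Suc j) * (1 - s) ^ j)
     = - p * (pochhammer (p + 1) j / fact j * (1 + e) powr (- (p + 1) - j) * (1 - s) ^ j)"
    proof -
      have 1: "- p - real (Suc j) = - (p + 1) - real j" by simp
      have 2: "pochhammer p (Suc j) / fact (Suc j) * - real (Suc j) = - p * (pochhammer (p + 1) j / fact j)"
        by (simp add: pochhammer_rec add.commute[of p] divide_simps del: of_nat_Suc)
      have "?a (Suc j) * (- real (Suc j) * (1 - s) ^ j)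
        = (pochhammer p (Suc j) / fact (Suc j) * - real (Suc j)) * ((1 + e) powr (- p - real (Suc j)) * (1 - s) ^ j)"
        by (simp only: mult.assoc mult.left_commute mult.commute)
      then show ?thesis unfolding 1 2 by (simp only: mult.assoc)
    qed
  qed
  finally show ?thesis .
qed

lemma taylor_powr_at_1: "0 < N \<Longrightarrow> taylor_powr p e N 1 = (1 + e) powr (- p)"
  by (cases N) (simp_all only: taylor_powr_def sum.lessThan_Suc_shift, simp)

text \<open>Gluing needs both the function and its derivative to vanish at s = 1. The derivative
  contains only \<open>N\<close> Taylor terms, hence the requirement that \<open>N\<close> be
  positive.\<close>

lemma DERIV_kern:
  assumes "- e < s" "0 < e" "0 < N"
  shows "(kern p e (Suc N) has_real_derivative - p * kern (p + 1) e N s) (at s)"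
proof -
  have "(kern p e (Suc N) has_real_derivative
      (if s < 1 then - p * (s + e) powr (- (p + 1)) - - p * taylor_powr (p + 1) e N s else 0)) (at s)"
    unfolding kern_def[abs_def]
    by (rule DERIV_glue[where f = "\<lambda>s. (s + e) powr (- p) - taylor_powr p e (Suc N) s"])
       (use assms DERIV_diff[OF DERIV_powr_shift[OF assms(1), of "- p"] DERIV_taylor_powr[of p e N s]] in
          \<open>auto simp: taylor_powr_at_1\<close>)
  moreover have "(if s < 1 then - p * (s + e) powr (- (p + 1)) - - p * taylor_powr (p + 1) e N s else 0)
      = - p * kern (p + 1) e N s"
    by (simp add: kern_def algebra_simps)
  ultimately show ?thesis by simp
qed

lemma C_k_on_kern:
  assumes "0 < e"
  shows "C_k_on k (kern p e (Suc k)) {- e<..}"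
proof (induction k arbitrary: p)
  case 0
  \<comment> \<open>With a single Taylor term only a constant is subtracted, and truncating the
    result means freezing the argument at 1.\<close>
  have "kern p e (Suc 0) = (\<lambda>s. (min s 1 + e) powr (- p) - (1 + e) powr (- p))"
    by (auto simp: kern_def taylor_powr_def fun_eq_iff min_def)
  then show ?case using assms by (auto intro!: continuous_intros)
next
  case (Suc k)
  show ?case
    by (rule C_k_on_real_SucI[OF open_greaterThan DERIV_kern C_k_on_cmult[OF open_greaterThan Suc]])
       (use assms in auto)
qed

section \<open>Powers of s + e under the iterated radial operator\<close>

lemma C_k_on_powr: "C_k_on k (\<lambda>s. (s + e) powr q) {- e<..}" for e q :: real
proof (induction k arbitrary: q)
  case 0
  then show ?case by (auto intro!: continuous_intros)
next
  case (Suc k)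
  show ?case
    by (rule C_k_on_real_SucI[OF open_greaterThan _ C_k_on_cmult[OF open_greaterThan Suc[of "q - 1"], of q]])
       (use DERIV_powr_shift in auto)
qed

text \<open>Writing the factor s of the second-order term as (s+e) - e leaves two pure powers of s +
  e, so that the operator can be iterated.\<close>

lemma radial_op_powr:
  assumes "- e < s"
  shows "radial_op d (\<lambda>s. (s + e) powr (- q)) s
    = - 4 * (q * (d / 2 - q - 1) * (s + e) powr (- q - 1) + q * (q + 1) * e * (s + e) powr (- q - 2))"
proof -
  have "radial_op d (\<lambda>s. (s + e) powr (- q)) s
    = 4 * s * (- q * ((- q - 1) * (s + e) powr (- q - 1 - 1))) + 2 * d * (- q * (s + e) powr (- q - 1))"
    using radial_op_eq[OF open_greaterThan _ DERIV_powr_shift DERIV_cmult[OF DERIV_powr_shift], of s "- e" e d "- q"] assms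
    by (simp add: mult.assoc)
  also have "- q - 1 - 1 = - q - 2" by simp
  also have *: "(s + e) powr (- q - 1) = (s + e) powr (- q - 2) * (s + e)"
  proof -
    have "1 + (- q - 2) = - q - 1" by simp
    with powr_mult_base[of "s + e" "- q - 2"] assms show ?thesis by (simp only: mult.commute)
  qed
  finally show ?thesis unfolding * by (simp add: algebra_simps)
qed

text \<open>For q = p + j + i and p = d/2 - m the first coefficient in \<open>radial_op_powr\<close>
  contains the factor m - 1 - j - i, and its second term raises i by one. This yields the
  recurrence, and \<open>b\<close> solves it by the absorption identity of binomial coefficients.
  For j = m the product contains the factor 0 unless i = m.\<close>

lemma radial_op_funpow_powr_coeff:
  fixes m j i :: nat
  defines "b \<equiv> \<lambda>j i. real (j choose i) * (\<Prod>l\<in>{i<..j}. real m - real l)"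
  shows "b (Suc j) 0 = (real m - 1 - real j) * b j 0"
    and "b (Suc j) (Suc i) = (real m - 1 - real j - real (Suc i)) * b j (Suc i) + b j i"
proof -
  have s: "{i<..Suc j} = insert (Suc j) {i<..j}" if "i \<le> j" for i using that by auto
  show "b (Suc j) 0 = (real m - 1 - real j) * b j 0"
    by (simp add: b_def s)
  have c: "b (Suc j) (Suc i) = (real m - 1 - real j - real (Suc i)) * b j (Suc i) + b j i" if "i < j"
  proof -
    define P where "P = (\<Prod>l\<in>{Suc i<..j}. real m - real l)"
    have i: "{i<..j} = insert (Suc i) {Suc i<..j}" using that by auto
    have 1: "(\<Prod>l\<in>{i<..j}. real m - real l) = (real m - real (Suc i)) * P" unfolding i P_def by simp
    have 2: "(\<Prod>l\<in>{Suc i<..Suc j}. real m - real l) = (real m - real (Suc j)) * P"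
      using s[of "Suc i"] that unfolding P_def by simp
    have "Suc i * (j choose Suc i) = (j - i) * (j choose i)"
      by (simp only: binomial_absorb_comp binomial_absorption)
    then have "real (Suc i) * real (j choose Suc i) = real (j - i) * real (j choose i)"
      unfolding of_nat_mult[symmetric] by simp
    then have 3: "real (Suc i) * real (j choose Suc i) = (real j - real i) * real (j choose i)"
      using that by (simp add: of_nat_diff)
    have "b (Suc j) (Suc i) - ((real m - 1 - real j - real (Suc i)) * b j (Suc i) + b j i)
      = (real (Suc i) * real (j choose Suc i) - (real j - real i) * real (j choose i)) * P"
      unfolding b_def 1 2 P_def[symmetric] by (simp add: algebra_simps)
    then show ?thesis using 3 by simp
  qed
  show "b (Suc j) (Suc i) = (real m - 1 - real j - real (Suc i)) * b j (Suc i) + b j i"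
  proof (cases i j rule: linorder_cases)
    case greater then show ?thesis by (simp add: b_def binomial_eq_0)
  qed (use c in \<open>auto simp: b_def\<close>)
qed

lemma radial_op_funpow_powr_sum:
  fixes m j :: nat and d e :: real
  defines "b \<equiv> \<lambda>j i. real (j choose i) * (\<Prod>l\<in>{i<..j}. real m - real l)"
  defines "p \<equiv> d / 2 - real m"
  assumes "- e < s"
  shows "(radial_op d ^^ j) (\<lambda>s. (s + e) powr (- p)) s
    = (- 4) ^ j * (\<Sum>i\<le>j. b j i * (pochhammer p (j + i) * e ^ i * (s + e) powr (- p - real (j + i))))"
  using assms(3)
proof (induction j arbitrary: s)
  case 0
  then show ?case by (simp add: b_def)
next
  case (Suc j)
  define c where "c i = (- 4) ^ j * (b j i * pochhammer p (j + i) * e ^ i)" for i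
  define Z where "Z i = pochhammer p (Suc j + i) * e ^ i * (s + e) powr (- p - real (Suc j + i))" for i
  let ?f = "\<lambda>i s. (s + e) powr (- (p + real (j + i)))"
  have "(radial_op d ^^ Suc j) (\<lambda>s. (s + e) powr (- p)) s = radial_op d (\<lambda>s. \<Sum>i\<le>j. c i * ?f i s) s"
    unfolding funpow.simps o_apply
  proof (rule radial_op_cong[OF open_greaterThan, of _ "- e"])
    fix t assume "t \<in> {- e<..}"
    then have t: "- e < t" by simp
    have "- (p + real k) = - p - real k" for k by simp
    with Suc.IH[OF t] show "(radial_op d ^^ j) (\<lambda>s. (s + e) powr (- p)) t = (\<Sum>i\<le>j. c i * ?f i t)"
      by (simp only: c_def sum_distrib_left mult_ac)
  qed (use Suc.prems in simp)
  also have "\<dots> = (\<Sum>i\<le>j. c i * radial_op d (?f i) s)"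
    using radial_op_funpow_sum[OF open_greaterThan, of "{..j}" 1 ?f "- e" s d c] Suc.prems
    by (simp add: C_k_on_powr)
  also have "\<dots> = (\<Sum>i\<le>j. (- 4) ^ Suc j * ((real m - 1 - real j - real i) * b j i * Z i + b j i * Z (Suc i)))"
  proof (rule sum.cong[OF refl])
    fix i
    let ?q = "p + real (j + i)"
    have 1: "d / 2 - ?q - 1 = real m - 1 - real j - real i" by (simp add: p_def)
    have 2: "- ?q - 1 = - p - real (Suc j + i)" "- ?q - 2 = - p - real (Suc j + Suc i)" by simp_all
    have 3: "pochhammer p (Suc j + i) = pochhammer p (j + i) * ?q"
      "pochhammer p (Suc j + Suc i) = pochhammer p (j + i) * ?q * (?q + 1)"
      by (simp_all add: pochhammer_Suc algebra_simps)
    show "c i * radial_op d (?f i) s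
        = (- 4) ^ Suc j * ((real m - 1 - real j - real i) * b j i * Z i + b j i * Z (Suc i))"
      unfolding radial_op_powr[OF Suc.prems, of d ?q] 1 2 c_def Z_def 3
      by (simp add: algebra_simps)
  qed
  also have "\<dots> = (- 4) ^ Suc j * ((\<Sum>i\<le>j. (real m - 1 - real j - real i) * b j i * Z i) + (\<Sum>i\<le>j. b j i * Z (Suc i)))"
    by (simp only: sum.distrib sum_distrib_left[symmetric])
  also have "(\<Sum>i\<le>j. (real m - 1 - real j - real i) * b j i * Z i)
      = (\<Sum>i\<le>Suc j. (real m - 1 - real j - real i) * b j i * Z i)"
    by (simp add: b_def binomial_eq_0)
  also have "\<dots> = b (Suc j) 0 * Z 0 + (\<Sum>i\<le>j. (real m - 1 - real j - real (Suc i)) * b j (Suc i) * Z (Suc i))"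
    unfolding sum.atMost_Suc_shift using radial_op_funpow_powr_coeff(1)[of j m] by (simp add: b_def)
  also have "b (Suc j) 0 * Z 0 + (\<Sum>i\<le>j. (real m - 1 - real j - real (Suc i)) * b j (Suc i) * Z (Suc i)) + (\<Sum>i\<le>j. b j i * Z (Suc i))
      = b (Suc j) 0 * Z 0 + (\<Sum>i\<le>j. b (Suc j) (Suc i) * Z (Suc i))"
    unfolding b_def radial_op_funpow_powr_coeff(2) by (simp only: distrib_right sum.distrib add.assoc)
  also have "\<dots> = (\<Sum>i\<le>Suc j. b (Suc j) i * Z i)"
    unfolding sum.atMost_Suc_shift ..
  finally show ?case by (simp only: Z_def)
qed

text \<open>The conformal bubble: at the critical exponent all but one of the coefficients vanish.\<close>

lemma radial_op_funpow_powr: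
  fixes m :: nat
  assumes "- e < s" "p = d / 2 - real m"
  shows "(radial_op d ^^ m) (\<lambda>s. (s + e) powr (- p)) s
    = (- 4) ^ m * (pochhammer p (2 * m) * e ^ m * (s + e) powr (- p - 2 * real m))"
proof -
  let ?t = "\<lambda>i. real (m choose i) * (\<Prod>l\<in>{i<..m}. real m - real l)
     * (pochhammer p (m + i) * e ^ i * (s + e) powr (- p - real (m + i)))"
  have "(radial_op d ^^ m) (\<lambda>s. (s + e) powr (- p)) s = (- 4) ^ m * (\<Sum>i\<le>m. ?t i)"
    unfolding assms(2) by (rule radial_op_funpow_powr_sum[OF assms(1)])
  also have "(\<Sum>i\<le>m. ?t i) = (\<Sum>i\<in>{m}. ?t i)"
  proof (rule sum.mono_neutral_right)
    show "\<forall>i\<in>{..m} - {m}. ?t i = 0"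
    proof
      fix i assume "i \<in> {..m} - {m}"
      then have "m \<in> {i<..m}" by auto
      then have "(\<Prod>l\<in>{i<..m}. real m - real l) = 0" by (intro prod_zero bexI[of _ m]) simp_all
      then show "?t i = 0" by simp
    qed
  qed auto
  also have "(\<Sum>i\<in>{m}. ?t i) = pochhammer p (m + m) * e ^ m * (s + e) powr (- p - real (m + m))"
    by simp
  finally show ?thesis unfolding mult_2[symmetric] of_nat_mult of_nat_numeral .
qed

section \<open>Bounds for the truncated kernel, uniform in the regularization\<close>

lemma C_k_on_one_minus_power: "C_k_on k (\<lambda>s::real. (1 - s) ^ j) UNIV"
proof (induction j)
  case (Suc j)
  have "C_k_on k (\<lambda>s::real. 1 - s) UNIV"
    using C_k_on_inner[of UNIV k 1 "-1 :: real"] by simp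
  with Suc show ?case by (simp add: C_k_on_mult)
qed (simp add: C_k_on_const)

text \<open>The coefficients are largest at e = 0, because 1 + e >= 1 carries a negative exponent,
  and the images of the finitely many powers of 1 - s are bounded on [0,1]. Uniformity in
  \<open>e\<close> matters, as \<open>e\<close> will be chosen arbitrarily small.\<close>

lemma taylor_powr_radial_op_bound:
  assumes "0 < p"
  obtains C where "\<And>e s. 0 \<le> e \<Longrightarrow> 0 \<le> s \<Longrightarrow> s \<le> 1 \<Longrightarrow> \<bar>(radial_op d ^^ m) (taylor_powr p e N) s\<bar> \<le> C"
proof -
  let ?L = "radial_op d ^^ m"
  let ?q = "\<lambda>j s. (1 - s :: real) ^ j"
  have "\<exists>B. \<forall>s\<in>{0..1}. \<bar>?L (?q j) s\<bar> \<le> B" for j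
  proof -
    have "continuous_on UNIV (?L (?q j))"
      by (rule C_k_on_imp_continuous[OF C_k_on_radial_op_funpow[OF open_UNIV, of 0]]) (rule C_k_on_one_minus_power)
    then have "bounded (?L (?q j) ` {0..1})"
      by (intro compact_imp_bounded compact_continuous_image) (auto intro: continuous_on_subset)
    then show ?thesis by (auto simp: bounded_iff)
  qed
  then have "\<forall>j. \<exists>B. \<forall>s\<in>{0..1}. \<bar>?L (?q j) s\<bar> \<le> B" by blast
  from choice[OF this] obtain B where B: "\<forall>j. \<forall>s\<in>{0..1}. \<bar>?L (?q j) s\<bar> \<le> B j" ..
  have "\<bar>?L (taylor_powr p e N) s\<bar> \<le> (\<Sum>j<N. pochhammer p j / fact j * B j)"
    if e: "0 \<le> e" and s: "0 \<le> s" "s \<le> 1" for e s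
  proof -
    define c where "c j = pochhammer p j / fact j * (1 + e) powr (- p - real j)" for j
    have c: "0 \<le> c j" "c j \<le> pochhammer p j / fact j" for j
    proof -
      have p: "0 \<le> pochhammer p j / fact j" using pochhammer_nonneg[OF assms, of j] by simp
      have "(1 + e) powr (- p - real j) \<le> (1 + e) powr 0"
        by (rule powr_mono) (use e assms in simp_all)
      then have "(1 + e) powr (- p - real j) \<le> 1" using e by simp
      from mult_left_le[OF this p] show "c j \<le> pochhammer p j / fact j" by (simp only: c_def)
      show "0 \<le> c j" unfolding c_def by (rule mult_nonneg_nonneg[OF p powr_ge_zero])
    qed
    have "?L (taylor_powr p e N) s = (\<Sum>j<N. c j * ?L (?q j) s)"
      unfolding taylor_powr_def[abs_def] c_def
      by (rule radial_op_funpow_sum[OF open_UNIV C_k_on_one_minus_power]) simp_all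
    also have "\<bar>\<dots>\<bar> \<le> (\<Sum>j<N. \<bar>c j * ?L (?q j) s\<bar>)" by (rule sum_abs)
    also have "\<dots> \<le> (\<Sum>j<N. pochhammer p j / fact j * B j)"
    proof (rule sum_mono)
      fix j
      have "\<bar>?L (?q j) s\<bar> \<le> B j" using B s by simp
      then have "c j * \<bar>?L (?q j) s\<bar> \<le> pochhammer p j / fact j * B j"
        using c[of j] by (intro mult_mono) linarith+
      then show "\<bar>c j * ?L (?q j) s\<bar> \<le> pochhammer p j / fact j * B j"
        using c(1)[of j] by (simp only: abs_mult abs_of_nonneg)
    qed
    finally show ?thesis .
  qed
  then show ?thesis using that by blast
qed

text \<open>The subtracted Taylor polynomial is nonnegative for s < 1, so truncation only lowers the
  power.\<close>

lemma kern_le_powr: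
  assumes "0 < p" "0 < e"
  shows "kern p e N s \<le> (s + e) powr (- p)"
proof -
  have "0 \<le> taylor_powr p e N s" if "s < 1"
    unfolding taylor_powr_def using that assms by (intro sum_nonneg mult_nonneg_nonneg) (auto intro!: divide_nonneg_nonneg pochhammer_nonneg)
  then show ?thesis by (simp add: kern_def)
qed

text \<open>The bubble contributes a positive multiple of e^m (s+e)^(-p-2m), since -(-4)^m = 4^m for
  odd m, and the Taylor part contributes at most a constant in absolute value. For s <= e the bubble
  term has size e^(-d/2), the inverse volume scale of the ball s <= e: an approximate point mass up
  to a bounded error.\<close>

lemma kern_radial_op:
  fixes m :: nat
  assumes m: "odd m" and p: "p = d / 2 - real m" "0 < p"
  obtains c C where "0 < c" "0 \<le> C"
    "\<And>e s. 0 < e \<Longrightarrow> 1 \<le> s \<Longrightarrow> (radial_op d ^^ m) (kern p e (Suc (2 * m))) s = 0"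
    "\<And>e s. 0 < e \<Longrightarrow> 0 \<le> s \<Longrightarrow> - C \<le> - (radial_op d ^^ m) (kern p e (Suc (2 * m))) s"
    "\<And>e s. 0 < e \<Longrightarrow> e < 1 \<Longrightarrow> 0 \<le> s \<Longrightarrow> s \<le> e \<Longrightarrow> 
       c * e powr (- d / 2) - C \<le> - (radial_op d ^^ m) (kern p e (Suc (2 * m))) s"
proof -
  let ?L = "radial_op d ^^ m"
  let ?N = "Suc (2 * m)"
  obtain C0 where C0: "\<And>e s. 0 \<le> e \<Longrightarrow> 0 \<le> s \<Longrightarrow> s \<le> 1 \<Longrightarrow> \<bar>?L (taylor_powr p e ?N) s\<bar> \<le> C0"
    using taylor_powr_radial_op_bound[OF p(2)] by metis
  define C where "C = max C0 0"
  define T where "T = 4 ^ m * pochhammer p (2 * m)"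
  \<comment> \<open>The power of 2 comes from s + e <= 2e in the concentration region.\<close>
  define c where "c = T * 2 powr (- p - 2 * real m)"
  have T: "0 < T" using p by (simp add: T_def pochhammer_pos)
  have in1: "- ?L (kern p e ?N) s = T * (e ^ m * (s + e) powr (- p - 2 * real m)) + ?L (taylor_powr p e ?N) s"
    if "0 < e" "0 \<le> s" "s < 1" for e s
  proof -
    have "?L (kern p e ?N) s = ?L (\<lambda>s. 1 * (s + e) powr (- p) + (-1) * taylor_powr p e ?N s) s"
      by (rule radial_op_funpow_cong[of "{- e<..<1}"]) (use that in \<open>auto simp: kern_def\<close>)
    also have "\<dots> = 1 * ?L (\<lambda>s. (s + e) powr (- p)) s + (-1) * ?L (taylor_powr p e ?N) s"
    proof (rule radial_op_funpow_lincomb[OF open_greaterThan C_k_on_powr])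
      have "C_k_on (2 * m) (taylor_powr p e ?N) UNIV"
        unfolding taylor_powr_def[abs_def]
        by (intro C_k_on_sum C_k_on_cmult open_UNIV C_k_on_one_minus_power)
      then show "C_k_on (2 * m) (taylor_powr p e ?N) {- e<..}" by (rule C_k_on_subset) auto
    qed (use that in auto)
    also have "?L (\<lambda>s. (s + e) powr (- p)) s = (- 4) ^ m * (pochhammer p (2 * m) * e ^ m * (s + e) powr (- p - 2 * real m))"
      using that by (intro radial_op_funpow_powr p) auto
    finally show ?thesis using m by (simp add: T_def algebra_simps)
  qed
  have out: "?L (kern p e ?N) s = 0" if "0 < e" "1 < s" for e s
  proof -
    \<comment> \<open>Zero is written as an empty sum so that linearity alone gives its
      image.\<close>
    have "?L (kern p e ?N) s = ?L (\<lambda>s. \<Sum>j\<in>({}::nat set). 0 * 0) s"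
      by (rule radial_op_funpow_cong[of "{1<..}"]) (use that in \<open>auto simp: kern_def\<close>)
    also have "\<dots> = 0"
      by (subst radial_op_funpow_sum[OF open_UNIV]) auto
    finally show ?thesis .
  qed
  \<comment> \<open>The point s = 1 lies in neither open region, so the value there is the limit
    from the right; the kernel is just smooth enough for this.\<close>
  have one: "?L (kern p e ?N) 1 = 0" if "0 < e" for e
  proof -
    have "continuous_on {- e<..} (?L (kern p e ?N))"
      using C_k_on_radial_op_funpow[of "{- e<..}" 0 m "kern p e ?N"] C_k_on_kern[OF that, of "2 * m"] by simp
    then have "isCont (?L (kern p e ?N)) 1"
      using that by (auto simp: continuous_on_eq_continuous_at)
    then have "(?L (kern p e ?N) \<longlongrightarrow> ?L (kern p e ?N) 1) (at_right 1)"
      by (auto simp: isCont_def intro: tendsto_mono[OF at_le])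
    moreover have "(?L (kern p e ?N) \<longlongrightarrow> 0) (at_right 1)"
      by (rule tendsto_eventually) (use out[OF that] in \<open>auto simp: eventually_at_filter\<close>)
    ultimately show ?thesis using tendsto_unique[OF trivial_limit_at_right_real] by blast
  qed
  show ?thesis
  proof (rule that[of c C])
    show "0 < c" "0 \<le> C" using T by (simp_all add: c_def C_def)
    show z: "?L (kern p e ?N) s = 0" if "0 < e" "1 \<le> s" for e s
      using that out one by (cases "s = 1") auto
    show "- C \<le> - ?L (kern p e ?N) s" if "0 < e" "0 \<le> s" for e s
    proof (cases "s < 1")
      case True
      have "0 \<le> T * (e ^ m * (s + e) powr (- p - 2 * real m))" using T that by simp
      then show ?thesis using in1[OF that True] C0[of e s] that True by (auto simp: C_def)
    next
      case False
      then show ?thesis using z that by (simp add: C_def)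
    qed
    show "c * e powr (- d / 2) - C \<le> - ?L (kern p e ?N) s" if "0 < e" "e < 1" "0 \<le> s" "s \<le> e" for e s
    proof -
      have "c * e powr (- d / 2) = T * (e ^ m * (2 * e) powr (- p - 2 * real m))"
      proof -
        have "- d / 2 = real m + (- p - 2 * real m)" using p by simp
        then have "e powr (- d / 2) = e ^ m * e powr (- p - 2 * real m)"
          using that by (simp only: powr_add powr_realpow)
        then show ?thesis using that by (simp add: c_def powr_mult)
      qed
      also have "\<dots> \<le> T * (e ^ m * (s + e) powr (- p - 2 * real m))"
        using T that p by (intro mult_left_mono powr_mono2') auto
      finally show ?thesis using in1[of e s] C0[of e s] that by (auto simp: C_def)
    qed
  qed
qed

section \<open>A global radial test function\<close>

text \<open>The integrands used below may be singular at 0, so the antiderivative is taken on the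
  open half-line and later normalized at 4.\<close>

lemma antiderivative_pos_exists:
  fixes f :: "real \<Rightarrow> real"
  assumes "continuous_on {0<..} f"
  obtains P where "\<And>x. 0 < x \<Longrightarrow> (P has_real_derivative f x) (at x)"
proof -
  have "isCont f x" if "0 < x" for x
    using assms that by (auto simp: continuous_on_eq_continuous_at)
  then have "\<exists>F. \<forall>x::real. ereal 0 < ereal x \<longrightarrow> ereal x < \<infinity> \<longrightarrow> (F has_vector_derivative f x) (at x)"
    by (intro einterval_antiderivative) auto
  then show ?thesis using that by (auto simp: has_real_derivative_iff_has_vector_derivative)
qed

lemma MVT_pos:
  fixes P :: "real \<Rightarrow> real"
  assumes "0 < a" "a < b" "\<And>x. 0 < x \<Longrightarrow> (P has_real_derivative g x) (at x)"
  obtains z where "a < z" "z < b" "P b - P a = (b - a) * g z"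
proof -
  have "\<exists>z>a. z < b \<and> P b - P a = (b - a) * g z"
    by (rule MVT2) (use assms in auto)
  then show ?thesis using that by blast
qed

text \<open>A class that is preserved when \<open>radial_op\<close> is inverted, up to the constant
  \<open>A\<close>. Under s = |x|^2 the bound is |x|^(2-d), the singularity of the fundamental
  solution of the Laplacian.\<close>

definition radial_profile :: "real \<Rightarrow> real \<Rightarrow> (real \<Rightarrow> real) \<Rightarrow> bool" where
  "radial_profile d A f \<longleftrightarrow> (\<forall>s>0. 0 \<le> f s \<and> f s \<le> A * s powr (1 - d / 2)) \<and> (\<forall>s\<ge>4. f s = 0)
     \<and> (\<forall>s. 0 < s \<longrightarrow> s < 4 \<longrightarrow> 0 < f s) \<and> (\<forall>s t. 0 < s \<longrightarrow> s \<le> t \<longrightarrow> f t \<le> f s)"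

text \<open>The operator has divergence form: it is 4 s^(1-d/2) times the derivative of s^(d/2) F'.
  Two integrations solve the equation, and both start at 4 so that the solution vanishes beyond 4.
  Positivity and monotonicity follow from the signs of the integrands.\<close>

lemma radial_op_solve:
  assumes d: "2 < d" and f: "radial_profile d A f" and Ck: "C_k_on k f {0<..}"
  obtains F where "radial_profile d (A / (d / 2 - 1)) F" "C_k_on (Suc (Suc k)) F {0<..}"
    "\<And>s. 0 < s \<Longrightarrow> radial_op d F s = f s"
proof -
  have f0: "0 \<le> f s" "f s \<le> A * s powr (1 - d / 2)" if "0 < s" for s
    using f that by (auto simp: radial_profile_def)
  have f4: "f s = 0" if "4 \<le> s" for s using f that by (auto simp: radial_profile_def)
  have fp: "0 < f s" if "0 < s" "s < 4" for s using f that by (auto simp: radial_profile_def)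
  have A: "0 \<le> A"
  proof -
    have "0 \<le> A * 4 powr (1 - d / 2)" using f0[of 4] by linarith
    moreover have "0 < (4::real) powr (1 - d / 2)" by simp
    ultimately show ?thesis by (metis zero_le_mult_iff not_less less_eq_real_def)
  qed
  have powC: "C_k_on j (\<lambda>s. s powr q) {0<..}" for j and q :: real
    using C_k_on_powr[of j 0 q] by simp
  define g where "g w = 1 / 4 * (w powr (d / 2 - 1) * f w)" for w
  have gC: "C_k_on k g {0<..}" unfolding g_def[abs_def]
    by (intro C_k_on_cmult C_k_on_mult powC Ck open_greaterThan)
  obtain P where P: "\<And>x. 0 < x \<Longrightarrow> (P has_real_derivative g x) (at x)"
    using antiderivative_pos_exists[OF C_k_on_imp_continuous[OF gC]] by blast
  define G where "G t = P 4 - P t" for t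
  have G': "(G has_real_derivative - 1 * g t) (at t)" if "0 < t" for t
    unfolding G_def[abs_def] using P[OF that] by (auto intro!: derivative_eq_intros)
  have GC: "C_k_on (Suc k) G {0<..}"
    by (rule C_k_on_real_SucI[OF open_greaterThan G' C_k_on_cmult[OF open_greaterThan gC]]) simp
  have G4: "G t = 0" if "4 \<le> t" for t
  proof (cases "t = 4")
    case False
    with that have "4 < t" by simp
    obtain z where "4 < z" "P t - P 4 = (t - 4) * g z"
      by (rule MVT_pos[OF _ \<open>4 < t\<close> P]) simp_all
    then show ?thesis using f4[of z] by (simp add: G_def g_def)
  qed (simp add: G_def)
  \<comment> \<open>The bound on \<open>f\<close> cancels the weight w^(d/2-1) and leaves an
    integrand of at most A/4 on an interval of length at most 4.\<close>
  have Gpos: "0 < G t \<and> G t \<le> A" if "0 < t" "t < 4" for t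
  proof -
    obtain z where z: "t < z" "z < 4" "P 4 - P t = (4 - t) * g z"
      by (rule MVT_pos[OF \<open>0 < t\<close> \<open>t < 4\<close> P])
    have "g z \<le> 1 / 4 * (z powr (d / 2 - 1) * (A * z powr (1 - d / 2)))"
      unfolding g_def using f0[of z] z that by (intro mult_left_mono) auto
    also have "z powr (d / 2 - 1) * (A * z powr (1 - d / 2)) = A * (z powr (d / 2 - 1) * z powr (1 - d / 2))"
      by simp
    also have "z powr (d / 2 - 1) * z powr (1 - d / 2) = z powr ((d / 2 - 1) + (1 - d / 2))"
      by (rule powr_add[symmetric])
    also have "\<dots> = 1" using z that by simp
    finally have "(4 - t) * g z \<le> 4 * (1 / 4 * A)"
      using that A fp[of z] z by (intro mult_mono) (auto simp: g_def)
    moreover have "0 < (4 - t) * g z" using that fp[of z] z by (auto simp: g_def)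
    ultimately show ?thesis using z by (simp add: G_def)
  qed
  have G0: "0 \<le> G t" "G t \<le> A" if "0 < t" for t
    using Gpos[OF that] G4[of t] A by (cases "t < 4"; force)+
  define h where "h t = t powr (- d / 2) * G t" for t
  have hC: "C_k_on (Suc k) h {0<..}" unfolding h_def[abs_def]
    by (intro C_k_on_mult powC GC open_greaterThan)
  obtain Q where Q: "\<And>x. 0 < x \<Longrightarrow> (Q has_real_derivative h x) (at x)"
    using antiderivative_pos_exists[OF C_k_on_imp_continuous[OF hC]] by blast
  define F where "F t = Q 4 - Q t" for t
  have F': "(F has_real_derivative - 1 * h t) (at t)" if "0 < t" for t
    unfolding F_def[abs_def] using Q[OF that] by (auto intro!: derivative_eq_intros)
  have FC: "C_k_on (Suc (Suc k)) F {0<..}"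
    by (rule C_k_on_real_SucI[OF open_greaterThan F' C_k_on_cmult[OF open_greaterThan hC]]) simp
  have anti: "F t \<le> F s" if "0 < s" "s \<le> t" for s t
  proof (cases "s = t")
    case False
    with that have "s < t" by simp
    obtain z where "s < z" "F t - F s = (t - s) * (- 1 * h z)"
      by (rule MVT_pos[OF \<open>0 < s\<close> \<open>s < t\<close> F'])
    moreover from this have "0 \<le> (t - s) * h z"
      using that G0[of z] by (auto simp: h_def)
    ultimately show ?thesis by simp
  qed simp
  have F4: "F t = 0" if "4 \<le> t" for t
  proof (cases "t = 4")
    case False
    with that have "4 < t" by simp
    obtain z where "4 < z" "Q t - Q 4 = (t - 4) * h z"
      by (rule MVT_pos[OF _ \<open>4 < t\<close> Q]) simp_all
    then show ?thesis using G4[of z] by (simp add: F_def h_def)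
  qed (simp add: F_def)
  have Fpos: "0 < F s" if "0 < s" "s < 4" for s
  proof -
    obtain z where z: "s < z" "z < 4" "Q 4 - Q s = (4 - s) * h z"
      by (rule MVT_pos[OF \<open>0 < s\<close> \<open>s < 4\<close> Q])
    moreover have "0 < h z" using Gpos[of z] z that by (auto simp: h_def)
    ultimately show ?thesis using that by (simp add: F_def)
  qed
  define B where "B = A / (d / 2 - 1)"
  have B: "0 \<le> B" "B * (d / 2 - 1) = A" using A d by (simp_all add: B_def)
  have Fle: "F s \<le> B * s powr (1 - d / 2)" if s: "0 < s" for s
  proof (cases "s < 4")
    case True
    \<comment> \<open>\<open>B\<close> is chosen so that the derivative of the difference becomes a
      multiple of A - G >= 0. The difference thus increases up to 4, where it is at most 0.\<close>
    let ?H = "\<lambda>s. F s - B * s powr (1 - d / 2)" and ?H' = "\<lambda>s. s powr (- d / 2) * (A - G s)"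
    have "(?H has_real_derivative ?H' t) (at t)" if "0 < t" for t
    proof -
      have "(?H has_real_derivative (- 1 * h t - B * ((1 - d / 2) * t powr (1 - d / 2 - 1)))) (at t)"
        using that by (intro DERIV_diff DERIV_cmult F' has_real_derivative_powr)
      also have "1 - d / 2 - 1 = - d / 2" by simp
      also have "- 1 * h t - B * ((1 - d / 2) * t powr (- d / 2)) = t powr (- d / 2) * (B * (d / 2 - 1) - G t)"
        by (simp add: h_def algebra_simps)
      finally show ?thesis unfolding B .
    qed
    note H' = this
    obtain z where "s < z" "?H 4 - ?H s = (4 - s) * ?H' z"
      by (rule MVT_pos[OF s True H'])
    moreover from this have "0 \<le> (4 - s) * ?H' z" using True s G0[of z] by (auto intro!: mult_nonneg_nonneg)
    moreover have "?H 4 \<le> 0" using F4[of 4] B by simp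
    ultimately show ?thesis by linarith
  next
    case False
    then show ?thesis using F4[of s] B by simp
  qed
  have "radial_op d F s = f s" if s: "0 < s" for s
  proof -
    have h': "((\<lambda>t. - 1 * h t) has_real_derivative
        - 1 * ((- d / 2) * s powr (- d / 2 - 1) * G s + (- 1 * g s) * s powr (- d / 2))) (at s)"
      unfolding h_def[abs_def] by (intro DERIV_cmult DERIV_mult has_real_derivative_powr s G')
    have "radial_op d F s = 4 * s * (- 1 * ((- d / 2) * s powr (- d / 2 - 1) * G s + (- 1 * g s) * s powr (- d / 2))) + 2 * d * (- 1 * h s)"
      by (rule radial_op_eq[OF open_greaterThan _ F' h']) (use s in auto)
    also have "\<dots> = 2 * d * (s * s powr (- d / 2 - 1)) * G s
        + (s * (s powr (d / 2 - 1) * s powr (- d / 2))) * f s - 2 * d * s powr (- d / 2) * G s"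
      by (simp add: g_def h_def algebra_simps)
    also have "s * s powr (- d / 2 - 1) = s powr (1 + (- d / 2 - 1))"
      using s by (intro powr_mult_base) simp
    also have "1 + (- d / 2 - 1) = - d / 2" by simp
    also have "s powr (d / 2 - 1) * s powr (- d / 2) = s powr (- 1)"
      unfolding powr_add[symmetric] by simp
    also have "s * s powr (- 1) = 1" using s by (simp add: powr_minus)
    finally show ?thesis by simp
  qed
  moreover have "0 \<le> F s" if "0 < s" for s
    using Fpos[OF that] F4[of s] by (cases "s < 4") force+
  ultimately show ?thesis
    using that[of F] FC F4 Fpos Fle anti by (simp add: radial_profile_def B_def)
qed

text \<open>Inverting \<open>radial_op\<close> m times from max 0 (4 - s) never leaves the class of
  profiles and gains two derivatives each time, so the continuous starting function ends as a C^(2m)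
  one.\<close>

lemma radial_test_function_exists:
  assumes d: "2 < d"
  obtains F A where "radial_profile d A F" "C_k_on (2 * m) F {0<..}"
    "\<And>s. 0 < s \<Longrightarrow> (radial_op d ^^ m) F s = max 0 (4 - s)"
proof -
  have "\<exists>F A. radial_profile d A F \<and> C_k_on (2 * m) F {0<..} \<and> (\<forall>s>0. (radial_op d ^^ m) F s = max 0 (4 - s))"
  proof (induction m)
    case 0
    let ?A = "4 * 4 powr (d / 2 - 1)"
    have "max 0 (4 - s) \<le> ?A * s powr (1 - d / 2)" if "0 < s" for s
    proof (cases "s < 4")
      case True
      have "?A * 4 powr (1 - d / 2) = 4 * 4 powr ((d / 2 - 1) + (1 - d / 2))"
        by (simp only: powr_add mult.assoc)
      then have "max 0 (4 - s) \<le> ?A * 4 powr (1 - d / 2)" using that by simp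
      also have "\<dots> \<le> ?A * s powr (1 - d / 2)"
        using True that d by (intro mult_left_mono powr_mono2') auto
      finally show ?thesis .
    qed simp
    then have "radial_profile d ?A (\<lambda>s. max 0 (4 - s))"
      unfolding radial_profile_def by auto
    moreover have "C_k_on (2 * 0) (\<lambda>s::real. max 0 (4 - s)) {0<..}"
      by (auto intro!: continuous_intros)
    ultimately show ?case by (metis funpow_0)
  next
    case (Suc m)
    then obtain f A where f: "radial_profile d A f" "C_k_on (2 * m) f {0<..}"
      "\<forall>s>0. (radial_op d ^^ m) f s = max 0 (4 - s)" by blast
    obtain F where F: "radial_profile d (A / (d / 2 - 1)) F" "C_k_on (Suc (Suc (2 * m))) F {0<..}"
      "\<And>s. 0 < s \<Longrightarrow> radial_op d F s = f s"
      using radial_op_solve[OF d f(1,2)] by blast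
    have "(radial_op d ^^ Suc m) F s = max 0 (4 - s)" if "0 < s" for s
    proof -
      have "(radial_op d ^^ Suc m) F s = (radial_op d ^^ m) (radial_op d F) s"
        by (simp add: funpow_swap1)
      also have "\<dots> = (radial_op d ^^ m) f s"
        by (rule radial_op_funpow_cong[of "{0<..}"]) (use that F(3) in auto)
      finally show ?thesis using f(3) that by simp
    qed
    moreover have "2 * Suc m = Suc (Suc (2 * m))" by simp
    ultimately show ?case using F(1,2) by metis
  qed
  then show ?thesis using that by blast
qed

section \<open>Mass bounds\<close>

lemma square_powr_neg:
  fixes x p :: real
  assumes "0 < x" "2 * p = real k"
  shows "(x\<^sup>2) powr (- p) = 1 / x ^ k"
proof -
  have "(x\<^sup>2) powr (- p) = (x powr 2) powr (- p)" using assms by simp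
  also have "\<dots> = x powr (- real k)" unfolding powr_powr using assms(2) by simp
  finally show ?thesis using assms by (simp add: powr_minus_divide powr_realpow)
qed

text \<open>The situation after the cutoff: \<open>V\<close> is smooth on the whole space, so
  integrals have no boundary terms, but the differential inequality survives only for norm at least
  1.\<close>

locale annular_polyharmonic =
  fixes V :: "'a::euclidean_space \<Rightarrow> real" and m :: nat
  assumes m_odd: "odd m" and dim: "2 * m < DIM('a)"
    and smooth: "C_k_on (2 * m) V UNIV"
    and nonneg: "0 \<le> V x"
    and zero: "norm x \<le> 1 / 2 \<Longrightarrow> V x = 0"
    and superharmonic: "1 \<le> norm x \<Longrightarrow> (laplacian ^^ m) V x \<le> 0"
begin

definition G :: "'a \<Rightarrow> real" where "G x = - (laplacian ^^ m) V x"

lemma continuous_V: "continuous_on S V"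
  using C_k_on_imp_continuous[OF smooth] by (rule continuous_on_subset) simp

lemma continuous_G: "continuous_on S G"
proof -
  have "continuous_on UNIV ((laplacian ^^ m) V)"
    using C_k_on_laplacian_funpow[of UNIV 0 m V] smooth by simp
  then show ?thesis unfolding G_def[abs_def] by (intro continuous_on_minus) (rule continuous_on_subset, auto)
qed

lemma G_zero: "norm x < 1 / 2 \<Longrightarrow> G x = 0"
  using laplacian_funpow_eq_0[of "ball 0 (1 / 2)" x V m] zero by (simp add: G_def)

lemma G_nonneg: "1 \<le> norm x \<Longrightarrow> 0 \<le> G x"
  using superharmonic by (simp add: G_def)

lemma integral_laplacian_test:
  assumes "C_k_on (2 * m) w UNIV" "\<And>x. r < norm x \<Longrightarrow> w x = 0"
  shows "(LINT x|lborel. V x * - (laplacian ^^ m) w x) = (LINT x|lborel. G x * w x)"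
    and "integrable lborel (\<lambda>x. V x * - (laplacian ^^ m) w x)" "integrable lborel (\<lambda>x. G x * w x)"
proof -
  show "(LINT x|lborel. V x * - (laplacian ^^ m) w x) = (LINT x|lborel. G x * w x)"
    using integral_laplacian_funpow_symmetric[OF smooth assms] by (simp add: G_def)
  have c: "continuous_on UNIV ((laplacian ^^ m) w)"
    using C_k_on_laplacian_funpow[of UNIV 0 m w] assms(1) by simp
  show "integrable lborel (\<lambda>x. V x * - (laplacian ^^ m) w x)"
  proof (rule integrable_compact_support)
    show "continuous_on UNIV (\<lambda>x. V x * - (laplacian ^^ m) w x)"
      by (intro continuous_intros continuous_V c)
    show "V x * - (laplacian ^^ m) w x = 0" if "r < norm x" for x
      using laplacian_funpow_eq_0[OF open_norm_greater[of r], of x w m] that assms(2) by simp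
  qed
  show "integrable lborel (\<lambda>x. G x * w x)"
  proof (rule integrable_compact_support)
    show "continuous_on UNIV (\<lambda>x. G x * w x)"
      by (intro continuous_on_mult continuous_G C_k_on_imp_continuous[OF assms(1)])
    show "G x * w x = 0" if "r < norm x" for x using assms(2)[OF that] by simp
  qed
qed

text \<open>For a test function with w >= 0 and \<open>\<Delta>^m w\<close> >= 0 on the region where
  V or G can be nonzero, the integrals of V \<open>\<Delta>^m w\<close> and of G w add up to zero.
  Both integrands are nonnegative outside the unit ball, and so is the first inside it. Hence they
  are controlled by the part of the integral of G w over the unit ball.\<close>

lemma mass_bounds:
  assumes "0 < m"
  obtains C where "0 \<le> C"
    "\<And>R. 1 \<le> R \<Longrightarrow> (LINT x:cball 0 R|lborel. V x) \<le> C * R ^ (DIM('a) - 2 + 2 * m)"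
    "\<And>R. 1 \<le> R \<Longrightarrow> (LINT x:cball 0 R - ball 0 1|lborel. G x) \<le> C * R ^ (DIM('a) - 2)"
proof -
  let ?n = "DIM('a)" and ?d = "real DIM('a)"
  have n3: "3 \<le> ?n" using assms dim by simp
  obtain F A where F: "radial_profile ?d A F" "C_k_on (2 * m) F {0<..}"
    "\<And>s. 0 < s \<Longrightarrow> (radial_op ?d ^^ m) F s = max 0 (4 - s)"
    by (rule radial_test_function_exists[of ?d m]) (use n3 in auto)
  obtain ct :: "real \<Rightarrow> real" where ct: "C_k_on (2 * m) ct UNIV" "\<And>t. 0 \<le> ct t"
    "\<And>t. t \<le> 0 \<Longrightarrow> ct t = 0" "\<And>t. 1 \<le> t \<Longrightarrow> ct t = 1"
    using smooth_cutoff_exists[of "2 * m"] by blast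
  have F0: "0 \<le> F s" "F s \<le> A * s powr (1 - ?d / 2)" if "0 < s" for s
    using F(1) that by (auto simp: radial_profile_def)
  have F4: "F s = 0" if "4 \<le> s" for s using F(1) that by (auto simp: radial_profile_def)
  have F1: "0 < F 1" using F(1) by (auto simp: radial_profile_def)
  have Fanti: "F t \<le> F s" if "0 < s" "s \<le> t" for s t using F(1) that by (auto simp: radial_profile_def)
  obtain B0 where B0: "\<forall>x\<in>cball 0 1. \<bar>G x\<bar> \<le> B0"
    using compact_imp_bounded[OF compact_continuous_image[OF continuous_G compact_cball, of 0 1]]
    by (auto simp: bounded_iff)
  define B where "B = max B0 0"
  have B: "0 \<le> B" "\<bar>G x\<bar> \<le> B" if "norm x \<le> 1" for x
    using B0 that by (auto simp: B_def le_max_iff_disj)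
  define K where "K = B * (\<bar>A\<bar> * 2 ^ (?n - 2)) * measure lborel (cball (0::'a) 1)"
  have K: "0 \<le> K" using B(1)[of 0] by (simp add: K_def)
  \<comment> \<open>A single inequality contains both bounds; each follows by dropping the other
    nonnegative term. \<open>K\<close> collects the maximum of |G| on the unit ball, the size of w
    there and the volume.\<close>
  have main: "3 * (1 / R\<^sup>2) ^ m * (LINT x:cball 0 R|lborel. V x) + F 1 * (LINT x:cball 0 R - ball 0 1|lborel. G x)
      \<le> K * R ^ (?n - 2)" if R: "1 \<le> R" for R
  proof -
    \<comment> \<open>This places |x| = R at s = 1 and the end of the support s = 4 at |x| = 2R. The
      factor c^m from the m Laplacians is the gap R^(2m) between the two mass bounds.\<close>
    define c where "c = 1 / R\<^sup>2"
    have c: "0 < c" using R by (simp add: c_def)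
    \<comment> \<open>The second factor removes the singularity at the origin: it is 0 for |x| <=
      1/4 and 1 for |x| >= 3/8. Neither V nor G notices it, since both vanish for |x| < 1/2.\<close>
    define w where "w x = F (c * (norm (x - 0))\<^sup>2) * ct (16 * (norm (x - 0))\<^sup>2 + (-1))" for x :: 'a
    have wC: "C_k_on (2 * m) w UNIV"
    proof -
      let ?W1 = "{x::'a. 0 < norm x}" and ?W2 = "{x::'a. norm x < 1 / 4}"
      have o: "open ?W1" "open ?W2" by (intro open_Collect_less continuous_intros)+
      have "C_k_on (2 * m) w ?W1"
        unfolding w_def[abs_def]
      proof (rule C_k_on_mult[OF o(1)])
        show "C_k_on (2 * m) (\<lambda>x. F (c * (norm (x - 0))\<^sup>2)) ?W1"
          by (rule C_k_on_radial[OF open_greaterThan F(2) o(1)]) (use c in auto)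
        show "C_k_on (2 * m) (\<lambda>x. ct (16 * (norm (x - 0))\<^sup>2 + (-1))) ?W1"
          by (rule C_k_on_compose[OF o(1) open_UNIV subset_UNIV _ ct(1)])
             (intro C_k_on_add C_k_on_const C_k_on_norm_sq o)
      qed
      moreover have "C_k_on (2 * m) w ?W2"
      proof (rule C_k_on_cong[OF o(2) _ C_k_on_const[of _ 0]])
        fix y :: 'a assume "y \<in> ?W2"
        then have "(norm y)\<^sup>2 \<le> (1 / 4)\<^sup>2" by (intro power_mono) auto
        then show "0 = w y" using ct(3)[of "16 * (norm y)\<^sup>2 + (-1)"] by (simp add: w_def power2_eq_square)
      qed
      ultimately have "C_k_on (2 * m) w (?W1 \<union> ?W2)" using o by (intro C_k_on_Un)
      moreover have "?W1 \<union> ?W2 = UNIV" by auto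
      ultimately show ?thesis by simp
    qed
    have w0: "w x = 0" if "2 * R < norm x" for x
    proof -
      have "(2 * R)\<^sup>2 \<le> (norm x)\<^sup>2" using that R by (intro power_mono) auto
      then have "4 \<le> c * (norm x)\<^sup>2" using R by (simp add: c_def field_simps)
      then show ?thesis by (simp add: w_def F4)
    qed
    let ?O = "{x::'a. 3 / 8 < norm x}"
    have O: "open ?O" by (rule open_norm_greater)
    have w1: "w x = F (c * (norm x)\<^sup>2)" if "x \<in> ?O" for x
    proof -
      have "(3 / 8)\<^sup>2 \<le> (norm x)\<^sup>2" using that by (intro power_mono) auto
      then have "1 \<le> 16 * (norm x)\<^sup>2 + (-1)" by (simp add: power2_eq_square)
      then show ?thesis using ct(4) by (simp add: w_def)
    qed
    have lw: "(laplacian ^^ m) w x = c ^ m * max 0 (4 - c * (norm x)\<^sup>2)" if "x \<in> ?O" for x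
    proof -
      have pos: "0 < c * (norm x)\<^sup>2" using c that by (intro mult_pos_pos zero_less_power) auto
      have "(laplacian ^^ m) w x = (laplacian ^^ m) (\<lambda>x. F (c * (norm (x - 0))\<^sup>2)) x"
        by (rule laplacian_funpow_cong[OF O that]) (use w1 in simp)
      also have "\<dots> = c ^ m * (radial_op ?d ^^ m) F (c * (norm (x - 0))\<^sup>2)"
        by (rule laplacian_funpow_radial[OF open_greaterThan F(2)]) (use pos in simp)
      finally show ?thesis using F(3) pos by simp
    qed
    note test = integral_laplacian_test[of w "2 * R", OF wC w0]
    \<comment> \<open>A pointwise minorant of an integrand with integral zero. On |x| <= R one has s
      <= 1, hence 4 - s >= 3 and, by monotonicity, w >= F 1 where G >= 0 is known.\<close>
    let ?l = "\<lambda>x. 3 * c ^ m * (indicator (cball 0 R) x *\<^sub>R V x) + F 1 * (indicator (cball 0 R - ball 0 1) x *\<^sub>R G x)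
       - B * (\<bar>A\<bar> * (2 * R) ^ (?n - 2)) * indicator (cball 0 1) x"
    have iV: "integrable lborel (\<lambda>x. indicator (cball 0 R) x *\<^sub>R V x)"
      by (intro borel_integrable_compact continuous_V) simp
    have iG: "integrable lborel (\<lambda>x. indicator (cball 0 R - ball 0 1) x *\<^sub>R G x)"
      by (intro borel_integrable_compact continuous_G compact_diff) auto
    have i1: "integrable lborel (indicator (cball 0 1) :: 'a \<Rightarrow> real)"
      by (intro integrable_real_indicator) (simp_all add: emeasure_lborel_cball_finite[unfolded infinity_ennreal_def])
    have "(LINT x|lborel. ?l x) \<le> (LINT x|lborel. G x * w x - V x * - (laplacian ^^ m) w x)"
    proof (rule integral_mono)
      show "integrable lborel ?l" using iV iG i1 by simp
      show "integrable lborel (\<lambda>x. G x * w x - V x * - (laplacian ^^ m) w x)" using test(2,3) by simp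
      fix x :: 'a
      have 1: "3 * c ^ m * (indicator (cball 0 R) x *\<^sub>R V x) \<le> - (V x * - (laplacian ^^ m) w x)"
      proof (cases "norm x \<le> 1 / 2")
        case True then show ?thesis using zero by simp
      next
        case False
        then have l: "(laplacian ^^ m) w x = c ^ m * max 0 (4 - c * (norm x)\<^sup>2)" by (intro lw) simp
        show ?thesis
        proof (cases "norm x \<le> R")
          case True
          then have "(norm x)\<^sup>2 \<le> R\<^sup>2" by (intro power_mono) auto
          then have "c * (norm x)\<^sup>2 \<le> 1" using R by (simp add: c_def)
          then have "c ^ m * V x * 3 \<le> c ^ m * V x * max 0 (4 - c * (norm x)\<^sup>2)"
            using c nonneg[of x] by (intro mult_left_mono) auto
          then show ?thesis using True l by (simp add: mult_ac)
        next
          case False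
          then show ?thesis using l c nonneg[of x] by simp
        qed
      qed
      have 2: "F 1 * (indicator (cball 0 R - ball 0 1) x *\<^sub>R G x)
       - B * (\<bar>A\<bar> * (2 * R) ^ (?n - 2)) * indicator (cball 0 1) x \<le> G x * w x"
      proof (cases "norm x < 1")
        case True
        show ?thesis
        proof (cases "norm x < 1 / 2")
          case t: True
          then show ?thesis using G_zero B(1)[of 0] R by simp
        next
          case False
          then have x: "1 / 2 \<le> norm x" by simp
          have "(1 / 2)\<^sup>2 \<le> (norm x)\<^sup>2" using x by (intro power_mono) auto
          then have s: "1 / (2 * R)\<^sup>2 \<le> c * (norm x)\<^sup>2" using R by (simp add: c_def field_simps power2_eq_square)
          have wF: "w x = F (c * (norm x)\<^sup>2)" using x by (intro w1) simp
          have "F (c * (norm x)\<^sup>2) \<le> F (1 / (2 * R)\<^sup>2)" by (rule Fanti[OF _ s]) (use R in simp)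
          also have "\<dots> \<le> A * (1 / (2 * R)\<^sup>2) powr (1 - ?d / 2)" by (rule F0) (use R in simp)
          also have "(1 / (2 * R)\<^sup>2) powr (1 - ?d / 2) = (1 / ((2 * R)\<^sup>2)) powr (- (?d / 2 - 1))" by simp
          also have "\<dots> = (((1 / (2 * R)))\<^sup>2) powr (- (?d / 2 - 1))"
            by (simp add: power_divide)
          also have "\<dots> = 1 / (1 / (2 * R)) ^ (?n - 2)"
            by (rule square_powr_neg) (use R n3 in \<open>auto simp: of_nat_diff\<close>)
          also have "\<dots> = (2 * R) ^ (?n - 2)" by (simp add: power_divide)
          also have "A * (2 * R) ^ (?n - 2) \<le> \<bar>A\<bar> * (2 * R) ^ (?n - 2)" using R by (intro mult_right_mono) auto
          finally have "w x \<le> \<bar>A\<bar> * (2 * R) ^ (?n - 2)" using wF by simp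
          moreover have "0 \<le> w x" using wF F0(1)[of "c * (norm x)\<^sup>2"] c x by (cases "x = 0") auto
          ultimately have "\<bar>G x\<bar> * w x \<le> B * (\<bar>A\<bar> * (2 * R) ^ (?n - 2))"
            using B[of x] True by (intro mult_mono) auto
          moreover have "- (\<bar>G x\<bar> * w x) \<le> G x * w x"
            using \<open>0 \<le> w x\<close> by (simp add: abs_if mult_le_0_iff)
          ultimately show ?thesis using True by simp
        qed
      next
        case False
        then have x1: "1 \<le> norm x" by simp
        then have wF: "w x = F (c * (norm x)\<^sup>2)" by (intro w1) simp
        have pos: "0 < c * (norm x)\<^sup>2" using c x1 by (intro mult_pos_pos zero_less_power) auto
        have nn: "0 \<le> B * (\<bar>A\<bar> * (2 * R) ^ (?n - 2)) * indicator (cball 0 1) x" using B(1)[of 0] R by simp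
        have "F 1 * (indicator (cball 0 R - ball 0 1) x *\<^sub>R G x) \<le> G x * w x"
        proof (cases "norm x \<le> R")
          case True
          then have "(norm x)\<^sup>2 \<le> R\<^sup>2" by (intro power_mono) auto
          then have "c * (norm x)\<^sup>2 \<le> 1" using R by (simp add: c_def)
          then have "F 1 \<le> w x" unfolding wF using pos by (intro Fanti)
          then have "G x * F 1 \<le> G x * w x" using G_nonneg[OF x1] by (rule mult_left_mono)
          then show ?thesis using True x1 by (simp add: mult.commute)
        next
          case False
          then show ?thesis using G_nonneg[OF x1] F0(1)[OF pos] wF by simp
        qed
        then show ?thesis using nn by linarith
      qed
      show "?l x \<le> G x * w x - V x * - (laplacian ^^ m) w x" using 1 2 by linarith
    qed
    also have "\<dots> = 0" using Bochner_Integration.integral_diff[OF test(3,2)] test(1) by simp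
    finally have "(LINT x|lborel. ?l x) \<le> 0" .
    moreover have "(LINT x|lborel. ?l x) = 3 * c ^ m * (LINT x:cball 0 R|lborel. V x) + F 1 * (LINT x:cball 0 R - ball 0 1|lborel. G x)
       - B * (\<bar>A\<bar> * (2 * R) ^ (?n - 2)) * measure lborel (cball (0::'a) 1)"
      using iV iG i1 by (simp add: set_lebesgue_integral_def)
    moreover have "B * (\<bar>A\<bar> * (2 * R) ^ (?n - 2)) * measure lborel (cball (0::'a) 1) = K * R ^ (?n - 2)"
      by (simp add: K_def power_mult_distrib)
    ultimately show ?thesis unfolding c_def by linarith
  qed
  have Vn: "0 \<le> (LINT x:cball 0 R|lborel. V x)" for R
    unfolding set_lebesgue_integral_def by (intro Bochner_Integration.integral_nonneg) (simp add: nonneg)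
  have Gn: "0 \<le> (LINT x:cball 0 R - ball 0 1|lborel. G x)" for R
    unfolding set_lebesgue_integral_def by (intro Bochner_Integration.integral_nonneg) (simp add: G_nonneg indicator_def)
  show ?thesis
  proof (rule that[of "K + K / F 1"])
    show "0 \<le> K + K / F 1" using K F1 by simp
    fix R :: real assume R: "1 \<le> R"
    note mR = main[OF R]
    have KR: "0 \<le> K * R ^ (?n - 2)" "0 \<le> K / F 1 * R ^ (?n - 2 + 2 * m)" "0 \<le> K / F 1 * R ^ (?n - 2)" using K R F1 by simp_all
    have "3 * (1 / R\<^sup>2) ^ m * (LINT x:cball 0 R|lborel. V x) \<le> K * R ^ (?n - 2)"
      using mR mult_nonneg_nonneg[OF less_imp_le[OF F1] Gn[of R]] by linarith
    moreover have "(1 / R\<^sup>2) ^ m = 1 / R ^ (2 * m)" by (simp add: power_divide power_mult)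
    ultimately have "3 * (LINT x:cball 0 R|lborel. V x) \<le> K * R ^ (?n - 2) * R ^ (2 * m)"
      using R by (simp add: field_simps)
    then have "(LINT x:cball 0 R|lborel. V x) \<le> K * R ^ (?n - 2 + 2 * m)"
      using Vn[of R] unfolding power_add mult.assoc by linarith
    then show "(LINT x:cball 0 R|lborel. V x) \<le> (K + K / F 1) * R ^ (?n - 2 + 2 * m)"
      using KR by (simp add: distrib_right)
    have "0 \<le> 3 * (1 / R\<^sup>2) ^ m * (LINT x:cball 0 R|lborel. V x)" using Vn[of R] by simp
    then have "F 1 * (LINT x:cball 0 R - ball 0 1|lborel. G x) \<le> K * R ^ (?n - 2)" using mR by linarith
    then have "(LINT x:cball 0 R - ball 0 1|lborel. G x) \<le> K / F 1 * R ^ (?n - 2)"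
      using F1 by (simp add: field_simps)
    then show "(LINT x:cball 0 R - ball 0 1|lborel. G x) \<le> (K + K / F 1) * R ^ (?n - 2)"
      using KR by (simp add: distrib_right)
  qed
qed

end

section \<open>The local estimate\<close>

lemma integral_lborel_affine:
  fixes f :: "'a::euclidean_space \<Rightarrow> real"
  assumes [measurable]: "f \<in> borel_measurable borel" and t: "0 < t"
  shows "(LINT x|lborel. f x) = t ^ DIM('a) * (LINT x|lborel. f (a + t *\<^sub>R x))"
proof -
  have "(LINT x|lborel. f x) = (LINT x|density (distr lborel borel (\<lambda>x. a + t *\<^sub>R x)) (\<lambda>_. \<bar>t\<bar> ^ DIM('a)). f x)"
    using lborel_affine[of t a] t by simp
  also have "\<dots> = (LINT x|distr lborel borel (\<lambda>x. a + t *\<^sub>R x). t ^ DIM('a) * f x)"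
    using t by (subst integral_density) auto
  also have "\<dots> = (LINT x|lborel. t ^ DIM('a) * f (a + t *\<^sub>R x))"
    by (rule integral_distr) auto
  finally show ?thesis by simp
qed

lemma continuous_on_regularized_kernel:
  "0 < e \<Longrightarrow> continuous_on S (\<lambda>z. ((norm (z - a))\<^sup>2 + e) powr q)"
  for a :: "'a::euclidean_space"
proof -
  assume "0 < e"
  then have "(norm (z - a))\<^sup>2 + e \<noteq> 0" for z by (smt (verit) zero_le_power2)
  then show ?thesis by (intro continuous_intros) auto
qed

lemma integral_kernel_scale:
  fixes a :: "'a::euclidean_space"
  assumes t: "0 < t" and e: "0 < e" and p: "real DIM('a) = 2 * p + real k"
  shows "(LINT z:cball a t|lborel. ((norm (z - a))\<^sup>2 + e) powr (- p))
    = t ^ k * (LINT z:cball 0 1|lborel. ((norm (z - 0 :: 'a))\<^sup>2 + e / t\<^sup>2) powr (- p))"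
proof -
  let ?f = "\<lambda>z. indicator (cball a t) z *\<^sub>R ((norm (z - a))\<^sup>2 + e) powr (- p)"
  have "?f \<in> borel_measurable borel"
    using borel_integrable_compact[OF compact_cball continuous_on_regularized_kernel[OF e], of a t a "- p"]
    by (simp add: borel_measurable_integrable)
  then have "(LINT z|lborel. ?f z) = t ^ DIM('a) * (LINT z|lborel. ?f (a + t *\<^sub>R z))"
    using t by (rule integral_lborel_affine)
  also have "(LINT z|lborel. ?f (a + t *\<^sub>R z))
    = (LINT z|lborel. t powr (- 2 * p) * (indicator (cball 0 1) z *\<^sub>R ((norm (z - 0 :: 'a))\<^sup>2 + e / t\<^sup>2) powr (- p)))"
  proof (rule Bochner_Integration.integral_cong[OF refl])
    fix z :: 'a
    have "(norm (t *\<^sub>R z))\<^sup>2 + e = t\<^sup>2 * ((norm z)\<^sup>2 + e / t\<^sup>2)"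
      using t by (simp add: power_mult_distrib field_simps)
    moreover have "(t\<^sup>2 * ((norm z)\<^sup>2 + e / t\<^sup>2)) powr (- p) = (t\<^sup>2) powr (- p) * ((norm z)\<^sup>2 + e / t\<^sup>2) powr (- p)"
      by (rule powr_mult)
    moreover have "(t\<^sup>2) powr (- p) = t powr (- 2 * p)"
    proof -
      have "(t\<^sup>2) powr (- p) = (t powr 2) powr (- p)" using t by simp
      then show ?thesis unfolding powr_powr by simp
    qed
    moreover have "indicator (cball a t) (a + t *\<^sub>R z) = (indicator (cball 0 1) z :: real)"
      using t by (auto simp: indicator_def dist_norm)
    ultimately show "?f (a + t *\<^sub>R z)
        = t powr (- 2 * p) * (indicator (cball 0 1) z *\<^sub>R ((norm (z - 0))\<^sup>2 + e / t\<^sup>2) powr (- p))" by simp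
  qed
  also have "\<dots> = t powr (- 2 * p) * (LINT z:cball 0 1|lborel. ((norm (z - 0 :: 'a))\<^sup>2 + e / t\<^sup>2) powr (- p))"
    unfolding set_lebesgue_integral_def by (rule integral_mult_right_zero)
  also have "t ^ DIM('a) * (t powr (- 2 * p) * (LINT z:cball 0 1|lborel. ((norm (z - 0 :: 'a))\<^sup>2 + e / t\<^sup>2) powr (- p)))
    = t ^ k * (LINT z:cball 0 1|lborel. ((norm (z - 0 :: 'a))\<^sup>2 + e / t\<^sup>2) powr (- p))"
  proof -
    have "t ^ DIM('a) * t powr (- 2 * p) = t powr (real DIM('a) + (- 2 * p))"
      using t by (simp only: powr_realpow[symmetric] powr_add)
    also have "\<dots> = t ^ k" using t p by (simp add: powr_realpow)
    finally show ?thesis by (simp only: mult.assoc[symmetric])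
  qed
  finally show ?thesis by (simp only: set_lebesgue_integral_def)
qed

text \<open>Comparing the unit ball with the ball of radius 1/2 by scaling bounds the integral
  in terms of itself with a factor less than 1.\<close>

lemma integral_kernel_unit_ball:
  assumes p: "real DIM('a::euclidean_space) = 2 * p + real k" and k: "0 < k" and p0: "0 < p"
  obtains C where "0 \<le> C"
    "\<And>e. 0 < e \<Longrightarrow> (LINT z:cball 0 1|lborel. ((norm (z - 0 :: 'a))\<^sup>2 + e) powr (- p)) \<le> C"
proof -
  let ?f = "\<lambda>e z. ((norm (z - 0 :: 'a))\<^sup>2 + e) powr (- p)"
  let ?I = "\<lambda>e. LINT z:cball 0 1|lborel. ?f e z"
  define M where "M = (1 / 4) powr (- p) * measure lborel (cball (0::'a) 1)"
  have i: "integrable lborel (\<lambda>z. indicator (cball 0 r) z *\<^sub>R ?f e z)" if "0 < e" for e r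
    by (intro borel_integrable_compact continuous_on_regularized_kernel that compact_cball)
  have "?I e \<le> 2 * M" if e: "0 < e" for e
  proof -
    have i1: "integrable lborel (indicator (cball 0 1) :: 'a \<Rightarrow> real)"
      by (intro integrable_real_indicator) (simp_all add: emeasure_lborel_cball_finite[unfolded infinity_ennreal_def])
    have "?I e \<le> (LINT z|lborel. indicator (cball 0 (1/2)) z *\<^sub>R ?f e z + (1 / 4) powr (- p) * indicator (cball 0 1) z)"
      unfolding set_lebesgue_integral_def
    proof (rule integral_mono)
      show "integrable lborel (\<lambda>z. indicator (cball 0 (1/2)) z *\<^sub>R ?f e z + (1 / 4) powr (- p) * indicator (cball 0 1) z)"
        using i[OF e, of "1/2"] i1 by simp
      fix z :: 'a
      show "indicator (cball 0 1) z *\<^sub>R ?f e z \<le> indicator (cball 0 (1/2)) z *\<^sub>R ?f e z + (1 / 4) powr (- p) * indicator (cball 0 1) z"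
      proof (cases "norm z \<le> 1 / 2")
        case True
        then show ?thesis by (simp add: indicator_def)
      next
        case False
        then have "(1 / 2)\<^sup>2 \<le> (norm z)\<^sup>2" by (intro power_mono) auto
        then have "1 / 4 \<le> (norm z)\<^sup>2 + e" using e by (simp add: power2_eq_square)
        then have "?f e z \<le> (1 / 4) powr (- p)" using p0 by (intro powr_mono2') auto
        then show ?thesis by (simp add: indicator_def)
      qed
    qed (rule i[OF e])
    also have "\<dots> = (LINT z:cball 0 (1/2)|lborel. ?f e z) + M"
      using i[OF e, of "1/2"] i1 by (simp add: set_lebesgue_integral_def M_def)
    also have "(LINT z:cball 0 (1/2)|lborel. ?f e z) = (1 / 2) ^ k * ?I (e / (1 / 2)\<^sup>2)"
      by (rule integral_kernel_scale[OF _ e p]) simp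
    finally have 1: "?I e \<le> (1 / 2) ^ k * ?I (e / (1 / 2)\<^sup>2) + M" .
    \<comment> \<open>Rescaling the half ball turns e into 4e, which only lowers the kernel. With
      the factor (1/2)^k <= 1/2 this gives I <= I/2 + M, and I is finite because e > 0.\<close>
    have 2: "?I (e / (1 / 2)\<^sup>2) \<le> ?I e"
      unfolding set_lebesgue_integral_def
    proof (rule integral_mono)
      fix z :: 'a
      have "(norm (z - 0))\<^sup>2 + e \<le> (norm (z - 0))\<^sup>2 + e / (1 / 2)\<^sup>2" using e by (simp add: power2_eq_square)
      moreover have "0 < (norm (z - 0))\<^sup>2 + e" using e by (smt (verit) zero_le_power2)
      ultimately have "?f (e / (1 / 2)\<^sup>2) z \<le> ?f e z" using p0 by (intro powr_mono2') auto
      then show "indicator (cball 0 1) z *\<^sub>R ?f (e / (1 / 2)\<^sup>2) z \<le> indicator (cball 0 1) z *\<^sub>R ?f e z"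
        by (simp add: indicator_def)
    qed (use e i in auto)
    have 3: "0 \<le> ?I e" unfolding set_lebesgue_integral_def by (rule Bochner_Integration.integral_nonneg) simp
    have "(1 / 2) ^ k * ?I (e / (1 / 2)\<^sup>2) \<le> (1 / 2) ^ k * ?I e" by (intro mult_left_mono 2) simp
    also have "\<dots> \<le> (1 / 2) * ?I e"
    proof (rule mult_right_mono[OF _ 3])
      show "(1 / 2 :: real) ^ k \<le> 1 / 2" using k power_decreasing[of 1 k "1/2 :: real"] by simp
    qed
    finally show ?thesis using 1 by linarith
  qed
  moreover have "0 \<le> 2 * M" by (simp add: M_def)
  ultimately show ?thesis using that by blast
qed

lemma integral_kernel_ball:
  assumes p: "real DIM('a::euclidean_space) = 2 * p + real k" and k: "0 < k" and p0: "0 < p"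
  obtains C where "0 \<le> C"
    "\<And>(a::'a) e t. 0 < e \<Longrightarrow> 0 < t \<Longrightarrow> (LINT z:cball a t|lborel. ((norm (z - a))\<^sup>2 + e) powr (- p)) \<le> C * t ^ k"
proof -
  obtain C where C: "0 \<le> C"
    "\<And>e. 0 < e \<Longrightarrow> (LINT z:cball 0 1|lborel. ((norm (z - 0 :: 'a))\<^sup>2 + e) powr (- p)) \<le> C"
    using integral_kernel_unit_ball[OF p k p0] by blast
  have "(LINT z:cball a t|lborel. ((norm (z - a))\<^sup>2 + e) powr (- p)) \<le> C * t ^ k"
    if "0 < e" "0 < t" for a :: 'a and e t
    unfolding integral_kernel_scale[OF that(2,1) p] mult.commute[of C]
    by (intro mult_left_mono C(2)) (use that in auto)
  then show ?thesis using that C(1) by blast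
qed

section \<open>Pointwise bounds from the mass bounds\<close>

context annular_polyharmonic
begin

text \<open>The test function is the truncated bubble centered at y on the ball of radius |y|/2. The
  three terms arise from the bounded error of the bubble against the mass of V, from G within
  distance t of y, where the kernel has integral of order t^(2m), and from G farther away, where the
  kernel is bounded and the mass of G is known.\<close>

lemma local_estimate:
  assumes m0: "0 < m"
  obtains C where "0 \<le> C"
    "\<And>y t g. \<lbrakk>2 \<le> norm y; 0 < t; t \<le> norm y / 2; 0 \<le> g; \<And>z. z \<in> cball y t \<Longrightarrow> G z \<le> g\<rbrakk> \<Longrightarrow>
       V y \<le> C * (norm y ^ (2 * m - 2) + g * t ^ (2 * m) + norm y ^ (DIM('a) - 2) / t ^ (DIM('a) - 2 * m))"
proof -
  let ?n = "DIM('a)" and ?d = "real DIM('a)"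
  define \<kappa> where "\<kappa> = ?n - 2 * m"
  define p where "p = ?d / 2 - real m"
  have n: "?n = 2 * m + \<kappa>" "0 < \<kappa>" using dim by (auto simp: \<kappa>_def)
  have p\<kappa>: "2 * p = real \<kappa>" using n by (simp add: p_def field_simps)
  have p0: "0 < p" using n p\<kappa> by simp
  let ?L = "radial_op ?d ^^ m" and ?N = "Suc (2 * m)"
  obtain c0 C0 where c0: "0 < c0" and C0: "0 \<le> C0"
    and k1: "\<And>e s. 0 < e \<Longrightarrow> 1 \<le> s \<Longrightarrow> ?L (kern p e ?N) s = 0"
    and k2: "\<And>e s. 0 < e \<Longrightarrow> 0 \<le> s \<Longrightarrow> - C0 \<le> - ?L (kern p e ?N) s"
    and k3: "\<And>e s. 0 < e \<Longrightarrow> e < 1 \<Longrightarrow> 0 \<le> s \<Longrightarrow> s \<le> e \<Longrightarrow> c0 * e powr (- ?d / 2) - C0 \<le> - ?L (kern p e ?N) s"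
    by (rule kern_radial_op[OF m_odd p_def p0]) blast
  have pd: "?d = 2 * p + real (2 * m)" using p_def by simp
  obtain C1 where C1: "0 \<le> C1"
    and J: "\<And>(a::'a) e t. 0 < e \<Longrightarrow> 0 < t \<Longrightarrow> (LINT z:cball a t|lborel. ((norm (z - a))\<^sup>2 + e) powr (- p)) \<le> C1 * t ^ (2 * m)"
    by (rule integral_kernel_ball[OF pd _ p0]) (use m0 in auto)
  obtain C2 where C2: "0 \<le> C2"
    and mV: "\<And>R. 1 \<le> R \<Longrightarrow> (LINT x:cball 0 R|lborel. V x) \<le> C2 * R ^ (?n - 2 + 2 * m)"
    and mG: "\<And>R. 1 \<le> R \<Longrightarrow> (LINT x:cball 0 R - ball 0 1|lborel. G x) \<le> C2 * R ^ (?n - 2)"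
    by (rule mass_bounds[OF m0]) blast
  define \<omega> where "\<omega> = measure lborel (ball (0::'a) 1)"
  have \<omega>: "0 < \<omega>" unfolding \<omega>_def by (simp add: content_ball_pos)
  have ball: "measure lborel (cball y r) = \<omega> * r ^ ?n" if "0 \<le> r" for y :: 'a and r
    using that by (simp add: \<omega>_def content_ball content_cball)
  define D where "D = (C0 * C2 * 4 ^ (?n - 2 + 2 * m) + C1 + C2 * 4 ^ (?n - 2)) / (c0 * \<omega>)"
  have "V y \<le> D * (norm y ^ (2 * m - 2) + g * t ^ (2 * m) + norm y ^ (?n - 2) / t ^ (?n - 2 * m))"
    if y: "2 \<le> norm y" and t: "0 < t" "t \<le> norm y / 2" and g: "0 \<le> g" and Gg: "\<And>z. z \<in> cball y t \<Longrightarrow> G z \<le> g"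
    for y t g
  proof (rule ccontr)
    define \<rho> where "\<rho> = norm y / 2"
    have \<rho>: "1 \<le> \<rho>" "norm y = 2 * \<rho>" using y by (auto simp: \<rho>_def)
    define E where "E = D * (norm y ^ (2 * m - 2) + g * t ^ (2 * m) + norm y ^ (?n - 2) / t ^ (?n - 2 * m))"
    assume "\<not> V y \<le> D * (norm y ^ (2 * m - 2) + g * t ^ (2 * m) + norm y ^ (?n - 2) / t ^ (?n - 2 * m))"
    \<comment> \<open>A value strictly below V y is exceeded on a whole neighborhood of y. One fixed
      small regularization then suffices instead of a limit e -> 0.\<close>
    then obtain v where v: "E < v" "v < V y" using dense unfolding E_def[symmetric] not_le by blast
    have "isCont V y" using continuous_V[of UNIV] by (simp add: continuous_on_eq_continuous_at)
    then have "\<forall>\<^sub>F z in nhds y. v < V z"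
      using order_tendstoD(1)[of V "V y" "nhds y" v] v by (simp add: isCont_def tendsto_at_iff_tendsto_nhds)
    then obtain \<delta> where \<delta>: "0 < \<delta>" "\<And>z. dist z y < \<delta> \<Longrightarrow> v < V z"
      unfolding eventually_nhds_metric by blast
    \<comment> \<open>The concentration ball of radius \<open>\<eta> * \<rho>\<close> must lie in
      that neighborhood, and \<open>\<eta>\<close> < 1 is needed for e < 1.\<close>
    define \<eta> where "\<eta> = min (\<delta> / (2 * \<rho>)) (1 / 2)"
    have \<eta>: "0 < \<eta>" "\<eta> < 1" "\<eta> * \<rho> < \<delta>"
      using \<delta> \<rho> by (auto simp: \<eta>_def min_def field_simps)
    define e where "e = \<eta>\<^sup>2"
    have e: "0 < e" "e < 1" using \<eta> by (auto simp: e_def power_less_one_iff)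
    \<comment> \<open>The support s <= 1 becomes the ball of radius \<open>\<rho>\<close> about y.
      As |y| = 2\<open>\<rho>\<close> and \<open>\<rho>\<close> >= 1, it stays at norm at least 1,
      where G >= 0.\<close>
    define c where "c = 1 / \<rho>\<^sup>2"
    have c: "0 < c" using \<rho> by (simp add: c_def)
    define s where "s z = c * (norm (z - y))\<^sup>2" for z
    define w where "w z = kern p e ?N (s z)" for z
    have s0: "0 \<le> s z" for z using c by (simp add: s_def)
    have s_le: "s z \<le> r\<^sup>2 \<longleftrightarrow> norm (z - y) \<le> r * \<rho>" if "0 \<le> r" for z r
    proof -
      have "s z \<le> r\<^sup>2 \<longleftrightarrow> (norm (z - y))\<^sup>2 \<le> (r * \<rho>)\<^sup>2" using \<rho> by (simp add: s_def c_def field_simps)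
      also have "\<dots> \<longleftrightarrow> norm (z - y) \<le> r * \<rho>" using that \<rho> by (simp add: power2_le_iff_abs_le)
      finally show ?thesis .
    qed
    have kC: "C_k_on (2 * m) (kern p e ?N) {- e<..}" using e by (intro C_k_on_kern)
    have se: "c * (norm (z - y))\<^sup>2 \<in> {- e<..}" for z
      using s0[of z] e by (simp add: s_def)
    have wC: "C_k_on (2 * m) w UNIV" unfolding w_def[abs_def] s_def
      by (rule C_k_on_radial[OF open_greaterThan kC open_UNIV se])
    have w0: "w z = 0" if "3 * \<rho> < norm z" for z
    proof -
      have "\<rho> < norm (z - y)" using that \<rho> norm_triangle_ineq2[of z y] by simp
      then have "\<not> s z \<le> 1\<^sup>2" using s_le[of 1 z] by simp
      then show ?thesis by (simp add: w_def kern_def)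
    qed
    have lw: "- (laplacian ^^ m) w z = c ^ m * - ?L (kern p e ?N) (s z)" for z
    proof -
      have "(laplacian ^^ m) w z = c ^ m * ?L (kern p e ?N) (c * (norm (z - y))\<^sup>2)"
        unfolding w_def[abs_def] s_def
        by (rule laplacian_funpow_radial[OF open_greaterThan kC se])
      then show ?thesis by (simp add: s_def)
    qed
    note test = integral_laplacian_test[of w "3 * \<rho>", OF wC w0]
    let ?K = "\<lambda>z. ((norm (z - y))\<^sup>2 + e * \<rho>\<^sup>2) powr (- p)"
    have e\<rho>: "0 < e * \<rho>\<^sup>2" using e \<rho> by simp
    have ind: "integrable lborel (\<lambda>z. indicator S z *\<^sub>R V z)" "integrable lborel (\<lambda>z. indicator S z *\<^sub>R G z)"
      "integrable lborel (\<lambda>z. indicator S z *\<^sub>R ?K z)" if "compact S" for S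
      using that e\<rho> by (auto intro!: borel_integrable_compact continuous_V continuous_G continuous_on_regularized_kernel simp del: real_scaleR_def)
    have lower: "c ^ m * (c0 * e powr (- ?d / 2)) * (LINT z:cball y (\<eta> * \<rho>)|lborel. V z) - c ^ m * C0 * (LINT z:cball y \<rho>|lborel. V z)
      \<le> (LINT z|lborel. V z * - (laplacian ^^ m) w z)"
    proof -
      have "(LINT z|lborel. c ^ m * (c0 * e powr (- ?d / 2)) * (indicator (cball y (\<eta> * \<rho>)) z *\<^sub>R V z) - c ^ m * C0 * (indicator (cball y \<rho>) z *\<^sub>R V z))
        \<le> (LINT z|lborel. V z * - (laplacian ^^ m) w z)"
      proof (rule integral_mono)
        fix z
        consider "norm (z - y) \<le> \<eta> * \<rho>" | "\<eta> * \<rho> < norm (z - y)" "norm (z - y) \<le> \<rho>" | "\<rho> < norm (z - y)"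
          by linarith
        then show "c ^ m * (c0 * e powr (- ?d / 2)) * (indicator (cball y (\<eta> * \<rho>)) z *\<^sub>R V z) - c ^ m * C0 * (indicator (cball y \<rho>) z *\<^sub>R V z)
          \<le> V z * - (laplacian ^^ m) w z"
        proof cases
          case 1
          then have "s z \<le> e" using s_le[of \<eta> z] \<eta> by (simp add: e_def)
          then have "c ^ m * V z * (c0 * e powr (- ?d / 2) - C0) \<le> c ^ m * V z * - ?L (kern p e ?N) (s z)"
            using c nonneg[of z] by (intro mult_left_mono k3 e s0) auto
          moreover have "norm (z - y) \<le> \<rho>" using 1 \<eta> \<rho> by (smt (verit) mult_left_le_one_le)
          ultimately show ?thesis using 1 unfolding lw
            by (simp add: indicator_def dist_norm norm_minus_commute algebra_simps)
        next
          case 2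
          have "c ^ m * V z * (- C0) \<le> c ^ m * V z * - ?L (kern p e ?N) (s z)"
            using c nonneg[of z] by (intro mult_left_mono k2 e s0) auto
          then show ?thesis using 2 unfolding lw
            by (simp add: indicator_def dist_norm norm_minus_commute algebra_simps)
        next
          case 3
          then have "\<not> s z \<le> 1\<^sup>2" using s_le[of 1 z] by simp
          then have "?L (kern p e ?N) (s z) = 0" using e by (intro k1) auto
          moreover have "\<eta> * \<rho> < norm (z - y)" using 3 \<eta> \<rho> by (smt (verit) mult_left_le_one_le)
          ultimately show ?thesis using 3 unfolding lw
            by (simp add: indicator_def dist_norm norm_minus_commute)
        qed
      qed (use ind(1)[of "cball y \<rho>"] ind(1)[of "cball y (\<eta> * \<rho>)"] test(2) in simp_all)
      then show ?thesis using ind(1)[of "cball y \<rho>"] ind(1)[of "cball y (\<eta> * \<rho>)"]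
        by (simp add: set_lebesgue_integral_def)
    qed
    \<comment> \<open>Split at distance t from y: inside, G <= g and w is at most the rescaled
      power; outside, w is at most the power at distance t, namely
      (\<open>\<rho>\<close>/t)^\<open>\<kappa>\<close>.\<close>
    have upper: "(LINT z|lborel. G z * w z) \<le> \<rho> ^ \<kappa> * g * (LINT z:cball y t|lborel. ?K z)
       + (\<rho> / t) ^ \<kappa> * (LINT z:cball 0 (4 * \<rho>) - ball 0 1|lborel. G z)"
    proof -
      have c\<rho>: "c powr (- p) = \<rho> ^ \<kappa>"
      proof -
        have "c powr (- p) = ((1 / \<rho>)\<^sup>2) powr (- p)" by (simp add: c_def power_divide)
        also have "\<dots> = 1 / (1 / \<rho>) ^ \<kappa>" using \<rho> p\<kappa> by (intro square_powr_neg) auto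
        finally show ?thesis by (simp add: power_divide)
      qed
      have cpt: "compact (cball 0 (4 * \<rho>) - ball 0 (1::real) :: 'a set)" by (intro compact_diff) auto
      have "(LINT z|lborel. G z * w z) \<le> (LINT z|lborel. \<rho> ^ \<kappa> * g * (indicator (cball y t) z *\<^sub>R ?K z)
         + (\<rho> / t) ^ \<kappa> * (indicator (cball 0 (4 * \<rho>) - ball 0 1) z *\<^sub>R G z))"
      proof (rule integral_mono)
        show "integrable lborel (\<lambda>z. \<rho> ^ \<kappa> * g * (indicator (cball y t) z *\<^sub>R ?K z)
         + (\<rho> / t) ^ \<kappa> * (indicator (cball 0 (4 * \<rho>) - ball 0 1) z *\<^sub>R G z))"
          using ind(3)[of "cball y t"] ind(2)[OF cpt] by simp
        fix z
        have A: "0 \<le> \<rho> ^ \<kappa> * g * (indicator (cball y t) z *\<^sub>R ?K z)"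
          using \<rho> g by simp
        have B: "0 \<le> (\<rho> / t) ^ \<kappa> * (indicator (cball 0 (4 * \<rho>) - ball 0 1) z *\<^sub>R G z)"
          using \<rho> t G_nonneg[of z] by (simp add: indicator_def)
        show "G z * w z \<le> \<rho> ^ \<kappa> * g * (indicator (cball y t) z *\<^sub>R ?K z)
         + (\<rho> / t) ^ \<kappa> * (indicator (cball 0 (4 * \<rho>) - ball 0 1) z *\<^sub>R G z)"
        proof (cases "norm (z - y) \<le> \<rho>")
          case False
          then have "\<not> s z \<le> 1\<^sup>2" using s_le[of 1 z] by simp
          then have "w z = 0" by (simp add: w_def kern_def)
          then show ?thesis using A B by simp
        next
          case True
          have z: "1 \<le> norm z" "norm z \<le> 4 * \<rho>"
            using True \<rho> norm_triangle_ineq2[of y z] norm_triangle_ineq2[of z y]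
            by (auto simp: norm_minus_commute)
          have Gz: "0 \<le> G z" using z by (intro G_nonneg)
          have wle: "w z \<le> (s z + e) powr (- p)"
            unfolding w_def by (rule kern_le_powr[OF p0 e(1)])
          show ?thesis
          proof (cases "norm (z - y) \<le> t")
            case True
            have "s z + e = c * ((norm (z - y))\<^sup>2 + e * \<rho>\<^sup>2)"
              using \<rho> by (simp add: s_def c_def field_simps)
            also have "\<dots> powr (- p) = c powr (- p) * ?K z"
              using c e\<rho> by (intro powr_mult)
            finally have "w z \<le> \<rho> ^ \<kappa> * ?K z" using wle c\<rho> by simp
            then have "G z * w z \<le> g * (\<rho> ^ \<kappa> * ?K z)"
              using True Gg[of z] Gz g \<rho>
              by (intro order.trans[OF mult_left_mono mult_right_mono]) (auto simp: dist_norm norm_minus_commute)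
            then show ?thesis using B True by (simp add: dist_norm norm_minus_commute mult_ac)
          next
            case False
            have "(t / \<rho>)\<^sup>2 \<le> s z"
            proof -
              have "t\<^sup>2 \<le> (norm (z - y))\<^sup>2" using False t by (intro power_mono) auto
              then show ?thesis using \<rho> by (simp add: s_def c_def power_divide divide_right_mono)
            qed
            then have "(s z + e) powr (- p) \<le> ((t / \<rho>)\<^sup>2) powr (- p)"
              using e p0 t \<rho> by (intro powr_mono2') auto
            also have "\<dots> = 1 / (t / \<rho>) ^ \<kappa>" using t \<rho> p\<kappa> by (intro square_powr_neg) auto
            also have "\<dots> = (\<rho> / t) ^ \<kappa>" by (simp add: power_divide)
            finally have "G z * w z \<le> G z * (\<rho> / t) ^ \<kappa>"
              using Gz wle by (intro mult_left_mono) auto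
            then show ?thesis using A z by (simp add: mult.commute)
          qed
        qed
      qed (rule test(3))
      then show ?thesis using ind(3)[of "cball y t"] ind(2)[OF cpt] by (simp add: set_lebesgue_integral_def)
    qed
    have Vball: "(LINT z:cball y \<rho>|lborel. V z) \<le> C2 * (4 * \<rho>) ^ (?n - 2 + 2 * m)"
    proof -
      have "(LINT z:cball y \<rho>|lborel. V z) \<le> (LINT z:cball 0 (4 * \<rho>)|lborel. V z)"
        unfolding set_lebesgue_integral_def
      proof (rule integral_mono)
        fix z
        have "norm z \<le> 4 * \<rho>" if "norm (z - y) \<le> \<rho>"
          using that \<rho> norm_triangle_ineq2[of z y] by auto
        then show "indicator (cball y \<rho>) z *\<^sub>R V z \<le> indicator (cball 0 (4 * \<rho>)) z *\<^sub>R V z"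
          using nonneg[of z] by (auto simp: indicator_def dist_norm norm_minus_commute)
      qed (use ind(1) in auto)
      also have "\<dots> \<le> C2 * (4 * \<rho>) ^ (?n - 2 + 2 * m)" using \<rho> by (intro mV) auto
      finally show ?thesis .
    qed
    have Vlow: "v * (\<omega> * (\<eta> * \<rho>) ^ ?n) \<le> (LINT z:cball y (\<eta> * \<rho>)|lborel. V z)"
    proof -
      have i1: "integrable lborel (indicator (cball y (\<eta> * \<rho>)) :: 'a \<Rightarrow> real)"
        by (intro integrable_real_indicator) (simp_all add: emeasure_lborel_cball_finite[unfolded infinity_ennreal_def])
      have "(LINT z|lborel. v * indicator (cball y (\<eta> * \<rho>)) z) \<le> (LINT z:cball y (\<eta> * \<rho>)|lborel. V z)"
        unfolding set_lebesgue_integral_def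
      proof (rule integral_mono)
        fix z
        show "v * indicator (cball y (\<eta> * \<rho>)) z \<le> indicator (cball y (\<eta> * \<rho>)) z *\<^sub>R V z"
          using \<delta>(2)[of z] \<eta>(3) by (auto simp: indicator_def dist_commute)
      qed (use i1 ind(1) in auto)
      moreover have "(LINT z|lborel. v * indicator (cball y (\<eta> * \<rho>)) z) = v * (\<omega> * (\<eta> * \<rho>) ^ ?n)"
        using \<eta> \<rho> i1 ball[of "\<eta> * \<rho>" y] by simp
      ultimately show ?thesis by linarith
    qed
    \<comment> \<open>The height of the approximate point mass cancels the volume of its ball, so
      \<open>\<eta>\<close> disappears from the final bound.\<close>
    have e\<eta>: "e powr (- ?d / 2) * \<eta> ^ ?n = 1"
    proof -
      have "e powr (- (?d / 2)) = 1 / \<eta> ^ ?n" unfolding e_def using \<eta> by (intro square_powr_neg) auto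
      then show ?thesis using \<eta> by simp
    qed
    have cm: "c ^ m * \<rho> ^ (2 * m) = 1" using \<rho> by (simp add: c_def power_divide power_mult)
    have "c ^ m * (c0 * e powr (- ?d / 2)) * (v * (\<omega> * (\<eta> * \<rho>) ^ ?n)) - c ^ m * C0 * (C2 * (4 * \<rho>) ^ (?n - 2 + 2 * m))
      \<le> c ^ m * (c0 * e powr (- ?d / 2)) * (LINT z:cball y (\<eta> * \<rho>)|lborel. V z) - c ^ m * C0 * (LINT z:cball y \<rho>|lborel. V z)"
      using c c0 C0 by (intro diff_mono mult_left_mono Vlow Vball) auto
    also have "\<dots> \<le> (LINT z|lborel. G z * w z)" using lower test(1) by simp
    also have "\<dots> \<le> \<rho> ^ \<kappa> * g * (LINT z:cball y t|lborel. ?K z)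
       + (\<rho> / t) ^ \<kappa> * (LINT z:cball 0 (4 * \<rho>) - ball 0 1|lborel. G z)" by (rule upper)
    also have "\<dots> \<le> \<rho> ^ \<kappa> * g * (C1 * t ^ (2 * m)) + (\<rho> / t) ^ \<kappa> * (C2 * (4 * \<rho>) ^ (?n - 2))"
      using \<rho> t g by (intro add_mono mult_left_mono J e\<rho> mG) auto
    finally have fin: "c ^ m * (c0 * e powr (- ?d / 2)) * (v * (\<omega> * (\<eta> * \<rho>) ^ ?n))
      \<le> c ^ m * C0 * (C2 * (4 * \<rho>) ^ (?n - 2 + 2 * m))
        + (\<rho> ^ \<kappa> * g * (C1 * t ^ (2 * m)) + (\<rho> / t) ^ \<kappa> * (C2 * (4 * \<rho>) ^ (?n - 2)))" by simp
    \<comment> \<open>Here and in \<open>r1\<close>, \<open>r2\<close> the common factor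
      \<open>\<rho>\<close>^\<open>\<kappa>\<close> is extracted in order to cancel it.\<close>
    have l: "c ^ m * (c0 * e powr (- ?d / 2)) * (v * (\<omega> * (\<eta> * \<rho>) ^ ?n)) = \<rho> ^ \<kappa> * (c0 * \<omega> * v)"
    proof -
      have "(\<eta> * \<rho>) ^ ?n = \<eta> ^ ?n * (\<rho> ^ (2 * m) * \<rho> ^ \<kappa>)"
        unfolding power_mult_distrib by (metis n(1) power_add)
      then have "c ^ m * (c0 * e powr (- ?d / 2)) * (v * (\<omega> * (\<eta> * \<rho>) ^ ?n))
        = (c ^ m * \<rho> ^ (2 * m)) * (e powr (- ?d / 2) * \<eta> ^ ?n) * (\<rho> ^ \<kappa> * (c0 * \<omega> * v))"
        by (simp only: mult_ac)
      then show ?thesis unfolding e\<eta> cm by simp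
    qed
    have r1: "c ^ m * C0 * (C2 * (4 * \<rho>) ^ (?n - 2 + 2 * m)) = \<rho> ^ \<kappa> * (C0 * C2 * 4 ^ (?n - 2 + 2 * m) * \<rho> ^ (2 * m - 2))"
    proof -
      have "?n - 2 + 2 * m = 2 * m + (\<kappa> + (2 * m - 2))" using n m0 by simp
      then have "(4 * \<rho>) ^ (?n - 2 + 2 * m) = 4 ^ (?n - 2 + 2 * m) * (\<rho> ^ (2 * m) * (\<rho> ^ \<kappa> * \<rho> ^ (2 * m - 2)))"
        unfolding power_mult_distrib by (metis power_add)
      then have "c ^ m * C0 * (C2 * (4 * \<rho>) ^ (?n - 2 + 2 * m))
        = (c ^ m * \<rho> ^ (2 * m)) * (\<rho> ^ \<kappa> * (C0 * C2 * 4 ^ (?n - 2 + 2 * m) * \<rho> ^ (2 * m - 2)))"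
        by (simp only: mult_ac)
      then show ?thesis unfolding cm by simp
    qed
    have r2: "\<rho> ^ \<kappa> * g * (C1 * t ^ (2 * m)) + (\<rho> / t) ^ \<kappa> * (C2 * (4 * \<rho>) ^ (?n - 2))
      = \<rho> ^ \<kappa> * (C1 * (g * t ^ (2 * m)) + C2 * 4 ^ (?n - 2) * (\<rho> ^ (?n - 2) / t ^ \<kappa>))"
      by (simp add: power_divide power_mult_distrib algebra_simps)
    have "c0 * \<omega> * v \<le> C0 * C2 * 4 ^ (?n - 2 + 2 * m) * \<rho> ^ (2 * m - 2)
        + (C1 * (g * t ^ (2 * m)) + C2 * 4 ^ (?n - 2) * (\<rho> ^ (?n - 2) / t ^ \<kappa>))"
      using fin \<rho> unfolding l r1 r2 distrib_left[symmetric] by simp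
    also have "\<dots> \<le> C0 * C2 * 4 ^ (?n - 2 + 2 * m) * norm y ^ (2 * m - 2)
        + (C1 * (g * t ^ (2 * m)) + C2 * 4 ^ (?n - 2) * (norm y ^ (?n - 2) / t ^ \<kappa>))"
      using \<rho> t C0 C1 C2 by (intro add_mono order_refl mult_left_mono power_mono divide_right_mono) auto
    also have "\<dots> \<le> (C0 * C2 * 4 ^ (?n - 2 + 2 * m) + C1 + C2 * 4 ^ (?n - 2))
        * (norm y ^ (2 * m - 2) + g * t ^ (2 * m) + norm y ^ (?n - 2) / t ^ \<kappa>)"
    proof -
      have *: "a * x + (b * y' + d * z) \<le> (a + b + d) * (x + y' + z)"
        if "0 \<le> a" "0 \<le> b" "0 \<le> d" "0 \<le> x" "0 \<le> y'" "0 \<le> z" for a b d x y' z :: real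
        using mult_nonneg_nonneg[OF that(1) that(5)] mult_nonneg_nonneg[OF that(1) that(6)]
          mult_nonneg_nonneg[OF that(2) that(4)] mult_nonneg_nonneg[OF that(2) that(6)]
          mult_nonneg_nonneg[OF that(3) that(4)] mult_nonneg_nonneg[OF that(3) that(5)]
        by (simp add: algebra_simps)
      show ?thesis by (rule *) (use C0 C1 C2 g t in auto)
    qed
    also have "\<dots> = c0 * \<omega> * E"
      using c0 \<omega> by (simp add: E_def D_def \<kappa>_def)
    finally have "c0 * \<omega> * v \<le> c0 * \<omega> * E" .
    then have "v \<le> E" using c0 \<omega> by simp
    then show False using v by simp
  qed
  moreover have "0 \<le> D" using C0 C1 C2 c0 \<omega> by (simp add: D_def)
  ultimately show ?thesis using that by blast
qed

end

section \<open>Growth\<close>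

text \<open>The radius balancing the last two terms either fits into the ball of radius d/2, and the
  growth bound for M follows by absorbing a power of M, or it does not. Then t = d/2 is best and
  multiplying by d^k removes the dependence on d from the singular term.\<close>

lemma optimize_radius:
  fixes C M d r \<sigma> b :: real and m k n :: nat
  defines "b \<equiv> 2 * real m * (real n - 2) / (real n - \<sigma> * real k)"
  assumes n: "n = 2 * m + k" "0 < m" "0 < k" and \<sigma>: "0 < \<sigma>" "\<sigma> * real k < real n"
    and C: "0 \<le> C" and M: "1 \<le> M" and r: "1 \<le> r" and d: "0 < d" "d \<le> r / 2"
    and est: "\<And>t. 0 < t \<Longrightarrow> t \<le> d / 2 \<Longrightarrow> M \<le> C * (r ^ (2 * m - 2) + M powr \<sigma> * t ^ (2 * m) + r ^ (n - 2) / t ^ k)"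
  shows "M \<le> (3 * C) powr (1 / (1 - \<sigma> * real k / real n)) * r powr b
    \<or> M * d ^ k \<le> C * (1 + 2 * 4 ^ k) * r powr b * (r / 2) ^ k"
proof -
  \<comment> \<open>\<open>\<theta>\<close> is the power of M left after balancing and
    \<open>q\<close> the accompanying power of r; solving M <= C r^q M^\<open>\<theta>\<close> gives
    \<open>b\<close> = q / (1 - \<open>\<theta>\<close>).\<close>
  define \<theta> where "\<theta> = \<sigma> * real k / real n"
  define q where "q = 2 * real m * (real n - 2) / real n"
  have n0: "0 < real n" using n by simp
  have n3: "3 \<le> n" using n by simp
  have \<theta>: "0 \<le> \<theta>" "\<theta> < 1" using \<sigma> n0 by (auto simp: \<theta>_def)
  have den: "real n - \<sigma> * real k = real n * (1 - \<theta>)" using n0 by (simp add: \<theta>_def field_simps)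
  have b: "b = q / (1 - \<theta>)" by (simp add: b_def q_def den)
  have q0: "0 \<le> q" using n3 by (simp add: q_def)
  have qb: "q \<le> b" unfolding b using q0 \<theta> by (simp add: field_simps mult_left_le)
  \<comment> \<open>Equivalent to n >= 2m; it makes the first term of the estimate harmless.\<close>
  have mq: "real (2 * m - 2) \<le> q"
  proof -
    have "real (2 * m - 2) = 2 * real m - 2" using n by (simp add: of_nat_diff)
    moreover have "(2 * real m - 2) * real n \<le> 2 * real m * (real n - 2)"
      using n by (simp add: algebra_simps)
    ultimately show ?thesis using n0 by (simp add: q_def field_simps)
  qed
  have rp: "r ^ (2 * m - 2) \<le> r powr q"
    using r mq by (simp add: powr_realpow[symmetric] powr_mono)
  have rb: "r ^ (2 * m - 2) \<le> r powr b"
    using rp r qb by (meson order.trans powr_mono)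
  \<comment> \<open>The solution of M^\<open>\<sigma>\<close> T^(2m) = r^(n-2) / T^k, using 2m + k =
    n.\<close>
  define T where "T = (r powr (real n - 2) * M powr (- \<sigma>)) powr (1 / real n)"
  have T0: "0 < T" using r M by (simp add: T_def)
  have Tn: "T ^ n = r ^ (n - 2) * M powr (- \<sigma>)"
  proof -
    have "T ^ n = T powr real n" using T0 by (simp add: powr_realpow)
    also have "\<dots> = r powr (real n - 2) * M powr (- \<sigma>)" using n0 r M by (simp add: T_def powr_powr)
    also have "r powr (real n - 2) = r powr real (n - 2)" using n3 by (simp add: of_nat_diff)
    finally show ?thesis using r by (simp add: powr_realpow)
  qed
  have MM: "M powr \<sigma> * M powr (- \<sigma>) = 1" using M by (simp add: powr_minus)
  show ?thesis
  proof (cases "T \<le> d / 2")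
    case True
    have e1: "M powr \<sigma> * T ^ (2 * m) = r ^ (n - 2) / T ^ k"
    proof -
      have "M powr \<sigma> * T ^ (2 * m) * T ^ k = M powr \<sigma> * T ^ n" using n by (simp add: power_add)
      also have "\<dots> = r ^ (n - 2)" unfolding Tn using MM by simp
      finally show ?thesis using T0 by (simp add: field_simps)
    qed
    have e2: "M powr \<sigma> * T ^ (2 * m) = M powr \<theta> * r powr q"
    proof -
      have "T ^ (2 * m) = T powr real (2 * m)" using T0 by (simp only: powr_realpow)
      also have "\<dots> = (r powr (real n - 2) * M powr (- \<sigma>)) powr (real (2 * m) / real n)"
        unfolding T_def powr_powr by simp
      also have "\<dots> = r powr ((real n - 2) * (real (2 * m) / real n)) * M powr (- \<sigma> * (real (2 * m) / real n))"
        by (simp only: powr_mult powr_powr)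
      also have "(real n - 2) * (real (2 * m) / real n) = q" by (simp add: q_def)
      finally have "M powr \<sigma> * T ^ (2 * m) = r powr q * (M powr \<sigma> * M powr (- \<sigma> * (real (2 * m) / real n)))"
        by simp
      also have "M powr \<sigma> * M powr (- \<sigma> * (real (2 * m) / real n)) = M powr (\<sigma> + - \<sigma> * (real (2 * m) / real n))"
        by (simp only: powr_add)
      also have "\<sigma> + - \<sigma> * (real (2 * m) / real n) = \<theta>"
        using n0 n by (simp add: \<theta>_def field_simps)
      finally show ?thesis by simp
    qed
    have "M \<le> C * (r ^ (2 * m - 2) + M powr \<sigma> * T ^ (2 * m) + r ^ (n - 2) / T ^ k)"
      by (rule est[OF T0 True])
    also have "\<dots> = C * (r ^ (2 * m - 2) + 2 * (M powr \<theta> * r powr q))"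
      unfolding e1[symmetric] unfolding e2 by simp
    also have "\<dots> \<le> C * (M powr \<theta> * r powr q + 2 * (M powr \<theta> * r powr q))"
    proof (intro mult_left_mono add_right_mono C)
      have "1 \<le> M powr \<theta>" using M \<theta> by (simp add: ge_one_powr_ge_zero)
      then have "1 * r powr q \<le> M powr \<theta> * r powr q" by (intro mult_right_mono) auto
      then show "r ^ (2 * m - 2) \<le> M powr \<theta> * r powr q" using rp by simp
    qed
    finally have "M \<le> (3 * C * r powr q) * M powr \<theta>" by (simp add: algebra_simps)
    moreover have "M = M powr (1 - \<theta>) * M powr \<theta>" using M by (simp add: powr_add[symmetric])
    moreover have "0 < M powr \<theta>" using M by simp
    ultimately have "M powr (1 - \<theta>) \<le> 3 * C * r powr q" by (metis mult_le_cancel_right_pos)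
    then have "(M powr (1 - \<theta>)) powr (1 / (1 - \<theta>)) \<le> (3 * C * r powr q) powr (1 / (1 - \<theta>))"
      using \<theta> by (intro powr_mono2) auto
    moreover have "(M powr (1 - \<theta>)) powr (1 / (1 - \<theta>)) = M" using \<theta> M by (simp add: powr_powr)
    moreover have "(3 * C * r powr q) powr (1 / (1 - \<theta>)) = (3 * C) powr (1 / (1 - \<theta>)) * r powr b"
      unfolding powr_mult powr_powr b by simp
    ultimately show ?thesis unfolding \<theta>_def by simp
  next
    case False
    \<comment> \<open>Below the balancing radius the last term dominates the middle one. After
      multiplication by d^k it becomes a multiple of r^(n-2) = r^(2m-2) r^k, which matches the
      weight (r/2)^k.\<close>
    define t where "t = d / 2"
    have t: "0 < t" "t \<le> T" "d = 2 * t" using d False by (auto simp: t_def)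
    have "M powr \<sigma> * t ^ n \<le> M powr \<sigma> * T ^ n" using t by (intro mult_left_mono power_mono) auto
    also have "\<dots> = r ^ (n - 2)" unfolding Tn using MM by simp
    finally have "M powr \<sigma> * t ^ (2 * m) * t ^ k \<le> r ^ (n - 2)" using n by (simp add: power_add mult.assoc)
    then have e1: "M powr \<sigma> * t ^ (2 * m) \<le> r ^ (n - 2) / t ^ k" using t by (simp add: field_simps)
    have "M \<le> C * (r ^ (2 * m - 2) + M powr \<sigma> * t ^ (2 * m) + r ^ (n - 2) / t ^ k)"
      by (rule est) (use t d in auto)
    also have "\<dots> \<le> C * (r ^ (2 * m - 2) + r ^ (n - 2) / t ^ k + r ^ (n - 2) / t ^ k)"
      using C e1 by (intro mult_left_mono add_mono) auto
    finally have "M * d ^ k \<le> C * (r ^ (2 * m - 2) + r ^ (n - 2) / t ^ k + r ^ (n - 2) / t ^ k) * d ^ k"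
      using d by (intro mult_right_mono) auto
    also have "\<dots> = C * (r ^ (2 * m - 2) * d ^ k + 2 * 2 ^ k * r ^ (n - 2))"
      using t by (simp add: power_mult_distrib field_simps)
    also have "\<dots> \<le> C * (r ^ (2 * m - 2) * (r / 2) ^ k + 2 * 2 ^ k * r ^ (n - 2))"
      using C r d by (intro mult_left_mono add_mono power_mono) auto
    also have "r ^ (n - 2) = r ^ (2 * m - 2) * (2 ^ k * (r / 2) ^ k)"
    proof -
      have "n - 2 = (2 * m - 2) + k" using n by simp
      then show ?thesis by (simp add: power_add power_mult_distrib[symmetric])
    qed
    also have "C * (r ^ (2 * m - 2) * (r / 2) ^ k + 2 * 2 ^ k * (r ^ (2 * m - 2) * (2 ^ k * (r / 2) ^ k)))
      = C * (1 + 2 * 4 ^ k) * r ^ (2 * m - 2) * (r / 2) ^ k"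
    proof -
      have "(4::real) ^ k = 2 ^ k * 2 ^ k" by (simp add: power_mult_distrib[symmetric])
      then show ?thesis by (simp add: algebra_simps)
    qed
    also have "\<dots> \<le> C * (1 + 2 * 4 ^ k) * r powr b * (r / 2) ^ k"
      using C r rb by (intro mult_right_mono mult_left_mono) auto
    finally show ?thesis by simp
  qed
qed

text \<open>At a maximum point of the weighted function, V near the point is controlled by its value
  at the point. This turns the nonlinear bound on G into a constant multiple of
  M^\<open>\<sigma>\<close> on a ball, as \<open>local_estimate\<close> requires.\<close>

lemma (in annular_polyharmonic) growth_bound:
  assumes m0: "0 < m" and A0: "0 \<le> A0" and \<sigma>: "0 < \<sigma>" "\<sigma> < real DIM('a) / (real DIM('a) - 2 * real m)"
    and G_le: "\<And>x. 1 \<le> norm x \<Longrightarrow> G x \<le> A0 * (1 + V x powr \<sigma>)"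
  obtains C where "\<And>y. 4 \<le> norm y \<Longrightarrow>
    V y \<le> C * norm y powr (2 * real m * (real DIM('a) - 2) / (real DIM('a) - \<sigma> * (real DIM('a) - 2 * real m)))"
proof -
  let ?n = "DIM('a)"
  define k where "k = ?n - 2 * m"
  have n: "?n = 2 * m + k" "0 < k" using dim by (auto simp: k_def)
  have rk: "real k = real ?n - 2 * real m" using dim by (simp add: k_def of_nat_diff)
  have \<sigma>k: "\<sigma> * real k < real ?n" using \<sigma>(2) n by (simp add: rk[symmetric] field_simps)
  obtain C0 where C0: "0 \<le> C0" and loc:
    "\<And>y t g. \<lbrakk>2 \<le> norm y; 0 < t; t \<le> norm y / 2; 0 \<le> g; \<And>z. z \<in> cball y t \<Longrightarrow> G z \<le> g\<rbrakk> \<Longrightarrow>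
       V y \<le> C0 * (norm y ^ (2 * m - 2) + g * t ^ (2 * m) + norm y ^ (?n - 2) / t ^ (?n - 2 * m))"
    by (rule local_estimate[OF m0]) blast
  \<comment> \<open>Accounts for V <= 2^k M near the maximum point; the summand 1 is absorbed by M
    >= 1.\<close>
  define A1 where "A1 = A0 * (1 + (2 ^ k) powr \<sigma>)"
  have A1: "0 \<le> A1" using A0 by (simp add: A1_def)
  \<comment> \<open>The power of 2 pays for replacing |y| <= 2r by r in the local estimate.\<close>
  define C where "C = C0 * (A1 + 2 ^ ?n)"
  have C: "0 \<le> C" using C0 A1 by (simp add: C_def)
  define b where "b = 2 * real m * (real ?n - 2) / (real ?n - \<sigma> * real k)"
  have b0: "0 \<le> b" using \<sigma>k n m0 by (simp add: b_def)
  \<comment> \<open>One summand for each alternative of \<open>optimize_radius\<close>, and 1 for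
    points with V <= 1.\<close>
  define D where "D = (3 * C) powr (1 / (1 - \<sigma> * real k / real ?n)) + C * (1 + 2 * 4 ^ k) + 1"
  have "V y0 \<le> D * norm y0 powr b" if y0: "4 \<le> norm y0" for y0
  proof (cases "V y0 \<le> 1")
    case True
    have "1 \<le> norm y0 powr b" using y0 b0 by (simp add: ge_one_powr_ge_zero)
    moreover have "1 \<le> D" using C by (simp add: D_def)
    ultimately have "1 * 1 \<le> D * norm y0 powr b" by (intro mult_mono) auto
    then show ?thesis using True by simp
  next
    case False
    define r where "r = norm y0"
    have r: "4 \<le> r" using y0 by (simp add: r_def)
    \<comment> \<open>The weight vanishes on the boundary, which forces an interior maximum.
      Comparing the maximum with the center gives V y0 (r/2)^k <= M d^k, the form of the second
      alternative of \<open>optimize_radius\<close>.\<close>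
    define \<phi> where "\<phi> z = V z * (r / 2 - norm (z - y0)) ^ k" for z
    have "continuous_on (cball y0 (r / 2)) \<phi>"
      unfolding \<phi>_def by (intro continuous_intros continuous_V)
    then obtain y where y: "y \<in> cball y0 (r / 2)" "\<And>z. z \<in> cball y0 (r / 2) \<Longrightarrow> \<phi> z \<le> \<phi> y"
      using continuous_attains_sup[OF compact_cball, of y0 "r / 2" \<phi>] r by auto
    define M where "M = V y"
    define d where "d = r / 2 - norm (y - y0)"
    have d_le: "d \<le> r / 2" by (simp add: d_def)
    have top: "V y0 * (r / 2) ^ k \<le> M * d ^ k"
      using y(2)[of y0] r by (simp add: \<phi>_def M_def d_def)
    moreover have "0 < V y0 * (r / 2) ^ k" using False r by simp
    moreover have "0 \<le> d" using y(1) by (simp add: d_def dist_norm norm_minus_commute)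
    ultimately have d: "0 < d" using n(2) by (cases "d = 0") (auto simp: zero_power)
    have "M * d ^ k \<le> M * (r / 2) ^ k" using d d_le nonneg[of y] by (intro mult_left_mono power_mono) (auto simp: M_def)
    with top have "V y0 * (r / 2) ^ k \<le> M * (r / 2) ^ k" by simp
    then have VM: "V y0 \<le> M" using r by simp
    then have M: "1 \<le> M" using False by simp
    have ny: "r / 2 \<le> norm y" "norm y \<le> 2 * r"
      using d norm_triangle_ineq2[of y0 y] norm_triangle_ineq2[of y y0]
      by (auto simp: d_def r_def norm_minus_commute)
    \<comment> \<open>Within distance d/2 of y the weight is at least (d/2)^k, so maximality costs
      only the factor 2^k.\<close>
    have Gz: "G z \<le> A1 * M powr \<sigma>" if z: "z \<in> cball y (d / 2)" for z
    proof -
      have "norm (z - y0) \<le> norm (z - y) + norm (y - y0)" using norm_triangle_ineq[of "z - y" "y - y0"] by simp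
      moreover have "norm (z - y) \<le> d / 2" using z by (simp add: dist_norm norm_minus_commute)
      ultimately have zd: "d / 2 \<le> r / 2 - norm (z - y0)" by (simp add: d_def)
      then have "norm (z - y0) \<le> r / 2" using d by simp
      then have "\<phi> z \<le> M * d ^ k" using y(2)[of z] by (simp add: \<phi>_def M_def d_def dist_norm norm_minus_commute)
      moreover have "V z * (d / 2) ^ k \<le> \<phi> z"
        unfolding \<phi>_def using zd d nonneg[of z] by (intro mult_left_mono power_mono) auto
      ultimately have "V z * (d / 2) ^ k \<le> M * d ^ k" by simp
      then have Vz: "V z \<le> 2 ^ k * M" using d by (simp add: power_divide field_simps)
      have "1 \<le> norm z" using \<open>norm (z - y0) \<le> r / 2\<close> r norm_triangle_ineq2[of y0 z]
        by (simp add: r_def norm_minus_commute)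
      then have "G z \<le> A0 * (1 + V z powr \<sigma>)" by (rule G_le)
      also have "\<dots> \<le> A0 * (M powr \<sigma> + (2 ^ k * M) powr \<sigma>)"
        using A0 \<sigma> Vz M nonneg[of z] by (intro mult_left_mono add_mono powr_mono2 ge_one_powr_ge_zero) auto
      also have "\<dots> = A1 * M powr \<sigma>" by (simp add: A1_def powr_mult algebra_simps)
      finally show ?thesis .
    qed
    have "M \<le> C * (r ^ (2 * m - 2) + M powr \<sigma> * t ^ (2 * m) + r ^ (?n - 2) / t ^ k)"
      if t: "0 < t" "t \<le> d / 2" for t
    proof -
      have "M \<le> C0 * (norm y ^ (2 * m - 2) + A1 * M powr \<sigma> * t ^ (2 * m) + norm y ^ (?n - 2) / t ^ (?n - 2 * m))"
        unfolding M_def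
      proof (rule loc)
        show "2 \<le> norm y" "t \<le> norm y / 2" using ny r t d_le by auto
        show "0 \<le> A1 * V y powr \<sigma>" using A1 by simp
        show "G z \<le> A1 * V y powr \<sigma>" if "z \<in> cball y t" for z
          using Gz[of z] that t by (simp add: M_def)
      qed (rule t)
      also have "\<dots> \<le> C0 * ((A1 + 2 ^ ?n) * r ^ (2 * m - 2) + (A1 + 2 ^ ?n) * (M powr \<sigma> * t ^ (2 * m)) + (A1 + 2 ^ ?n) * (r ^ (?n - 2) / t ^ k))"
      proof (intro mult_left_mono add_mono C0)
        have p: "norm y ^ j \<le> (A1 + 2 ^ ?n) * r ^ j" if "j \<le> ?n" for j
        proof -
          have "norm y ^ j \<le> (2 * r) ^ j" using ny by (intro power_mono) auto
          also have "\<dots> = 2 ^ j * r ^ j" by (rule power_mult_distrib)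
          also have "\<dots> \<le> (A1 + 2 ^ ?n) * r ^ j"
          proof (rule mult_right_mono)
            have "(2::real) ^ j \<le> 2 ^ ?n" using that by (intro power_increasing) auto
            then show "(2::real) ^ j \<le> A1 + 2 ^ ?n" using A1 by linarith
          qed (use r in simp)
          finally show ?thesis .
        qed
        show "norm y ^ (2 * m - 2) \<le> (A1 + 2 ^ ?n) * r ^ (2 * m - 2)" using n by (intro p) simp
        show "A1 * M powr \<sigma> * t ^ (2 * m) \<le> (A1 + 2 ^ ?n) * (M powr \<sigma> * t ^ (2 * m))"
          unfolding mult.assoc using t by (intro mult_right_mono) auto
        show "norm y ^ (?n - 2) / t ^ (?n - 2 * m) \<le> (A1 + 2 ^ ?n) * (r ^ (?n - 2) / t ^ k)"
          using divide_right_mono[OF p[of "?n - 2"], of "t ^ k"] t by (simp add: k_def)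
      qed
      also have "\<dots> = C * (r ^ (2 * m - 2) + M powr \<sigma> * t ^ (2 * m) + r ^ (?n - 2) / t ^ k)"
        unfolding C_def by (simp only: distrib_left[symmetric] mult.assoc)
      finally show ?thesis .
    qed
    from optimize_radius[OF n(1) m0 n(2) \<sigma>(1) \<sigma>k C M _ d d_le this]
    have "M \<le> (3 * C) powr (1 / (1 - \<sigma> * real k / real ?n)) * r powr b
      \<or> M * d ^ k \<le> C * (1 + 2 * 4 ^ k) * r powr b * (r / 2) ^ k"
      using r unfolding b_def by linarith
    then have "V y0 \<le> (3 * C) powr (1 / (1 - \<sigma> * real k / real ?n)) * r powr b \<or> V y0 \<le> C * (1 + 2 * 4 ^ k) * r powr b"
    proof
      assume "M * d ^ k \<le> C * (1 + 2 * 4 ^ k) * r powr b * (r / 2) ^ k"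
      with top have "V y0 * (r / 2) ^ k \<le> (C * (1 + 2 * 4 ^ k) * r powr b) * (r / 2) ^ k" by linarith
      then have "V y0 \<le> C * (1 + 2 * 4 ^ k) * r powr b"
        using r by (simp only: mult_le_cancel_right_pos zero_less_power)
      then show ?thesis ..
    qed (use VM in linarith)
    moreover have "(3 * C) powr (1 / (1 - \<sigma> * real k / real ?n)) * r powr b \<le> D * r powr b"
      "C * (1 + 2 * 4 ^ k) * r powr b \<le> D * r powr b"
      using C by (auto intro!: mult_right_mono simp: D_def)
    ultimately show ?thesis unfolding r_def by linarith
  qed
  then show ?thesis using that unfolding b_def rk by blast
qed

section \<open>Reduction of the theorem to the globally smooth setting\<close>

lemma bound_of_bigo_at_top:
  fixes f :: "real \<Rightarrow> real"
  assumes "continuous_on {0..} f" "f \<in> O[at_top](\<lambda>t. t powr \<sigma>)"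
  obtains A where "0 \<le> A" "\<And>t. 0 \<le> t \<Longrightarrow> f t \<le> A * (1 + t powr \<sigma>)"
proof -
  obtain c where c: "0 < c" "\<forall>\<^sub>F t in at_top. norm (f t) \<le> c * norm (t powr \<sigma>)"
    using assms(2) by (rule landau_o.bigE)
  then obtain N where N: "\<And>t. N \<le> t \<Longrightarrow> \<bar>f t\<bar> \<le> c * t powr \<sigma>"
    by (auto simp: eventually_at_top_linorder)
  have "bounded (f ` {0..N})"
    by (intro compact_imp_bounded compact_continuous_image continuous_on_subset[OF assms(1)]) auto
  then obtain B where B: "\<forall>t\<in>{0..N}. \<bar>f t\<bar> \<le> B" by (auto simp: bounded_iff)
  have "f t \<le> (c + \<bar>B\<bar>) * (1 + t powr \<sigma>)" if "0 \<le> t" for t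
  proof -
    have "f t \<le> \<bar>B\<bar> + c * t powr \<sigma>"
    proof (cases "t \<le> N")
      case True
      moreover have "0 \<le> c * t powr \<sigma>" using c by simp
      moreover have "\<bar>f t\<bar> \<le> B" using B True that by simp
      ultimately show ?thesis by linarith
    next
      case False
      then show ?thesis using N[of t] by simp
    qed
    also have "\<dots> \<le> (c + \<bar>B\<bar>) * (1 + t powr \<sigma>)" using c by (simp add: algebra_simps)
    finally show ?thesis .
  qed
  then show ?thesis using that[of "c + \<bar>B\<bar>"] c by simp
qed

theorem theorem1p14:
  fixes m :: nat and \<sigma> :: real and f :: "real \<Rightarrow> real"
    and v :: "'a::euclidean_space \<Rightarrow> real"
  assumes m_ge: "m \<ge> 3" and m_odd: "odd m"
    and dim: "2 * m < DIM('a)"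
    and f_cont: "continuous_on {0..} f"
    and f_nonneg: "\<And>t. t \<ge> 0 \<Longrightarrow> f t \<ge> 0"
    and f_growth: "f \<in> O[at_top](\<lambda>t. t powr \<sigma>)"
    and sigma_pos: "0 < \<sigma>"
    and sigma_bound: "\<sigma> < real DIM('a) / (real DIM('a) - 2 * real m)"
    and U_open: "open U"
    and U_sup: "- ball 0 (1/2) \<subseteq> U"
    and v_smooth: "C_k_on (2 * m) v U"
    and v_nonneg: "\<And>x. x \<in> - ball 0 (1/2) \<Longrightarrow> v x \<ge> 0"
    and ineq_lo: "\<And>x. x \<in> - ball 0 (1/2) \<Longrightarrow> 0 \<le> - (laplacian ^^ m) v x"
    and ineq_hi: "\<And>x. x \<in> - ball 0 (1/2) \<Longrightarrow> - (laplacian ^^ m) v x \<le> f (v x)"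
  shows "v \<in> O[at_infinity](\<lambda>y. norm y powr
           (2 * real m * (real DIM('a) - 2) / (real DIM('a) - \<sigma> * (real DIM('a) - 2 * real m))))"
proof -
  obtain ct :: "real \<Rightarrow> real" where ct: "C_k_on (2 * m) ct UNIV" "\<And>t. 0 \<le> ct t"
    "\<And>t. t \<le> 0 \<Longrightarrow> ct t = 0" "\<And>t. 1 \<le> t \<Longrightarrow> ct t = 1"
    using smooth_cutoff_exists[of "2 * m"] by blast
  \<comment> \<open>The cutoff is 0 for |x| <= 1/2 and 1 for |x| > 3/4, so that \<open>V\<close>
    agrees with \<open>v\<close> on an open set containing all points of norm at least 1.\<close>
  define V where "V x = ct (4 * (norm (x - 0))\<^sup>2 + (- 1)) * v x" for x :: 'a
  have V0: "V x = 0" if "norm x \<le> 1 / 2" for x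
  proof -
    have "(norm x)\<^sup>2 \<le> (1 / 2)\<^sup>2" using that by (intro power_mono) auto
    then show ?thesis using ct(3) by (simp add: V_def power2_eq_square)
  qed
  let ?O = "{x::'a. 3 / 4 < norm x}"
  have V1: "V x = v x" if "x \<in> ?O" for x
  proof -
    have "(3 / 4)\<^sup>2 \<le> (norm x)\<^sup>2" using that by (intro power_mono) auto
    then show ?thesis using ct(4) by (simp add: V_def power2_eq_square)
  qed
  have L: "(laplacian ^^ m) V x = (laplacian ^^ m) v x" if "x \<in> ?O" for x
    by (rule laplacian_funpow_cong[OF open_norm_greater that V1])
  \<comment> \<open>On U it is a product of smooth functions, and on the ball it is identically
    zero; the two open sets cover the space.\<close>
  have VC: "C_k_on (2 * m) V (U \<union> ball 0 (1 / 2))"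
  proof (intro C_k_on_Un U_open open_ball)
    show "C_k_on (2 * m) V U" unfolding V_def
      by (intro C_k_on_mult U_open v_smooth C_k_on_compose[OF U_open open_UNIV subset_UNIV _ ct(1)]
          C_k_on_add C_k_on_const C_k_on_norm_sq)
    show "C_k_on (2 * m) V (ball 0 (1 / 2))"
      by (rule C_k_on_cong[OF open_ball _ C_k_on_const[of _ 0]]) (use V0 in simp)
  qed
  have "U \<union> ball 0 (1 / 2) = UNIV" using U_sup by auto
  with VC have VC: "C_k_on (2 * m) V UNIV" by simp
  interpret annular_polyharmonic V m
  proof
    show "0 \<le> V x" for x
      using V0[of x] v_nonneg[of x] ct(2) by (cases "norm x \<le> 1 / 2") (auto simp: V_def)
    show "(laplacian ^^ m) V x \<le> 0" if "1 \<le> norm x" for x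
      using ineq_lo[of x] L[of x] that by simp
  qed (use m_odd dim VC V0 in auto)
  obtain A0 where A0: "0 \<le> A0" "\<And>t. 0 \<le> t \<Longrightarrow> f t \<le> A0 * (1 + t powr \<sigma>)"
    using bound_of_bigo_at_top[OF f_cont f_growth] by blast
  have "G x \<le> A0 * (1 + V x powr \<sigma>)" if x: "1 \<le> norm x" for x
    using ineq_hi[of x] v_nonneg[of x] A0(2)[of "v x"] L[of x] V1[of x] x by (simp add: G_def)
  then obtain C where C: "\<And>y. 4 \<le> norm y \<Longrightarrow>
    V y \<le> C * norm y powr (2 * real m * (real DIM('a) - 2) / (real DIM('a) - \<sigma> * (real DIM('a) - 2 * real m)))"
    using growth_bound[OF _ A0(1) sigma_pos sigma_bound] m_ge by force
  show ?thesis
  proof (rule bigoI)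
    show "\<forall>\<^sub>F y in at_infinity. norm (v y) \<le> C * norm (norm y powr
        (2 * real m * (real DIM('a) - 2) / (real DIM('a) - \<sigma> * (real DIM('a) - 2 * real m))))"
      unfolding eventually_at_infinity
    proof (intro exI[of _ 4] allI impI)
      fix y :: 'a assume "4 \<le> norm y"
      then show "norm (v y) \<le> C * norm (norm y powr
          (2 * real m * (real DIM('a) - 2) / (real DIM('a) - \<sigma> * (real DIM('a) - 2 * real m))))"
        using C[of y] V1[of y] v_nonneg[of y] by simp
    qed
  qed
qed

end
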